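(* Let $(\mathcal{C},\mathcal{D})$ be any one of the pairs $(\mathbf{MFrm},\mathbf{RelSp})$, $(\mathbf{MFrm},\mathbf{RelSp}^{l})$, $(\mathbf{MFrm},\mathbf{RelSpq})$, $(\mathbf{MFrm}^{\Diamond},\mathbf{RelSpq}^{l})$, $(\mathbf{MFrm}^{\Box},\mathbf{RelSpq}^{u})$, $(\mathbf{MFrm}^{\Box\Diamond},\mathbf{RelSpq}^{c})$, $(\mathbf{EqFrm},\mathbf{EqSpq})$. There is a duality (contravariant equivalence of categories) between the full subcategories of $\mathcal{C}$ and $\mathcal{D}$ whose objects lie in the images of the functors $\Omega:\mathcal{D}\to\mathcal{C}$ and $\mathcal{F}:\mathcal{C}\to\mathcal{D}$, respectively.
   Context: Relational spaces. A relational space $(X,\mathcal{O},R)$ is a topological space $(X,\mathcal{O})$ with an arbitrary binary relation $R\subseteq X\times X$. Write $R^{\rightarrow}(x)=\{x'\mid xRx'\}$. For $U\subseteq X$ put $\Box_R U=\{x\mid R^{\rightarrow}(x)\subseteq U\}$, $\Diamond_R U=\{x\mid R^{\rightarrow}(x)\cap U\neq\emptyset\}$. The space is upper-semicontinuous (u.s.c.) if $\Box_R U$ is open for all open $U$, lower-semicontinuous (l.s.c.) if $\Diamond_R U$ is open for all open $U$, continuous if both; it is an equivalence space if it is continuous and $R$ is an equivalence relation. A continuous function $f:(X,\mathcal{O},R)\to(Y,\mathcal{P},S)$ is a continuous p-morphism if (1) $xRx'\Rightarrow f(x)Sf(x')$ and (2) for all $U\in\mathcal{P}$, if $f(x)Sy$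 and $y\in U$ then there is $x'$ with $xRx'$ and $f(x')\in U$. It is a continuous pq-morphism if moreover (3) for all $U\in\mathcal{P}$, if $f(x)Sy$ and $y\notin U$ then there is $x'$ with $xRx'$ and $f(x')\notin U$. Categories: $\mathbf{RelSp}$, $\mathbf{RelSp}^l$ have as objects all, resp. l.s.c., relational spaces, with continuous p-morphisms; $\mathbf{RelSpq}$, $\mathbf{RelSpq}^l$, $\mathbf{RelSpq}^u$, $\mathbf{RelSpq}^c$, $\mathbf{EqSpq}$ have as objects all, l.s.c., u.s.c., continuous relational spaces, resp. equivalence spaces, with continuous pq-morphisms. Modal frames. A modal frame $(A,\Box,\Diamond)$ is a frame $A$ with monotone maps $\Box,\Diamond:A\to A$ such that for all $a,b$: $\top\le\Box\top$; $\Box a\wedge\Box b\le\Box(a\wedge b)$; $\Box a\wedge\Diamond b\le\Diamond(a\wedge b)$; $\Diamond\bot\le\bot$. An equivalence frame is a modal frame with, for all $a$: $\Box a\le a$, $a\le\Diamond a$, $\Box a\le\Box\Box a$, $\Diamond\Diamond a\le\Diamond a$, $\Diamond\Box a\le a$, $a\le\Box\Diamond a$. A modal frame morphism is a frame morphism $f$ with $f(\Box a)\le\Box f(a)$ and $f(\Diamond a)\le\Diamond f(a)$ for all $a$; it is box-strict (diamond-strict) if the first (second) is always an equality, strict if both are. $\mathbf{MFrm}$, $\mathbf{MFrm}^{\Box}$, $\mathbf{MFrm}^{\Diamond}$, $\mathbf{MFrm}^{\Box\Diamond}$: modal frames with all, box-strict, diamond-strict, strict morphisms; $\mathbf{EqFrm}$: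 equivalence frames with strict morphisms. The functor $\Omega$ (contravariant). $\Omega(X,\mathcal{O},R)=(\mathcal{O},\Box,\Diamond)$ with $\Box U$, $\Diamond U$ the interiors of $\Box_R U$, $\Diamond_R U$; $\Omega f=f^{-1}$. Point construction. Let $A$ be a modal frame. A frame character is a frame morphism $p:A\to\mathbf 2=\{0<1\}$; $\nabla(p)=\{a\mid p(a)=1\}$; $F_p=\{c\mid p(\Box c)=1\}$. Filters are nonempty up-closed subsets closed under binary meets (possibly all of $A$). Consider, for a frame character $p$, $a\in A$ and a filter $F\subseteq A$: (i) $p(\Diamond a)=0$; (ii) for all $c$, $p(\Diamond c)=0$ implies $c\le a$; (iii) $F_p\subseteq F$; (iv) $F\subseteq F_p$. Pre-points are: for $\mathbf{RelSp}$, pairs $(p,a)$ with (i); for $\mathbf{RelSp}^l$, pairs $(p,a)$ with (i),(ii); for $\mathbf{RelSpq}$, triples $(p,a,F)$ with (i),(iii); for $\mathbf{RelSpq}^l$, triples with (i),(ii),(iii); for $\mathbf{RelSpq}^u$, triples with (i),(iii),(iv); for $\mathbf{RelSpq}^c$ and $\mathbf{EqSpq}$, triples with (i)–(iv). Relation on pre-points: $(p,a)R_A(q,b)$ iff $q(a)=0$ and $p(\Box c)\le q(c)$ for all $c$; $(p,a,F)R_A(q,b,G)$ iff $q(a)=0$ and $F\subseteq\nabla(q)$. The set $\mathbb{P}_A$ of (modal frame) points is the largest set of pre-points such that: (D) for each point with first components $p,a$ and each $c\not\le a$ there is an $R_A$-related point with first component $q$ such that $q(c)=1$; and, in the triple versions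 only, also (B) for each point $(p,a,F)$ and each $c\notin F$ there is an $R_A$-related point with first component $q$ such that $q(c)=0$. Let $\phi_A(c)$ be the set of points whose first component $p$ has $p(c)=1$; the topology $\mathfrak{O}_A$ on $\mathbb{P}_A$ is $\{\phi_A(c)\mid c\in A\}$. The functor $\mathcal{F}$ (contravariant). $\mathcal{F}(A)=(\mathbb{P}_A,\mathfrak{O}_A,R_A)$ in the version attached to $\mathcal{D}$; for $f:A\to B$ in $\mathcal{C}$, $\mathcal{F}(f):\mathcal{F}(B)\to\mathcal{F}(A)$ sends a point $(q,b)$ to $(q\circ f,\bigvee\{c\mid f(c)\le b\})$, resp. $(q,b,G)$ to $(q\circ f,\bigvee\{c\mid f(c)\le b\},\{c\mid f(c)\in G\})$.
   Formalization: The second pair is proved as (MFrm^◇, RelSp^l) instead of (MFrm, RelSp^l): for morphisms that are not diamond-strict, F(f) need not preserve condition (ii), so F is not a functor MFrm → RelSp^l and the printed pair fails. *)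

theory Defs
  imports "HOL-Algebra.Complete_Lattice" "HOL-Analysis.Abstract_Topology"
begin

text \<open>
  Structures carry an explicit carrier (\<^const>\<open>carrier\<close>, resp. \<^const>\<open>topspace\<close>) inside an arbitrary
  type. Morphisms are extensional functions, so that equality of morphisms is equality of
  functions; composition is \<^const>\<open>compose\<close> and identities are restrictions of the identity.
\<close>

section \<open>Relational spaces\<close>

record 'x rspace =
  topo :: "'x topology"
  acc :: "'x rel"

definition rel_space :: "'x rspace \<Rightarrow> bool" where
  "rel_space X \<longleftrightarrow> acc X \<subseteq> topspace (topo X) \<times> topspace (topo X)"

definition box_rel :: "'x rspace \<Rightarrow> 'x set \<Rightarrow> 'x set" where
  "box_rel X U = {x \<in> topspace (topo X). acc X `` {x} \<subseteq> U}"

definition dia_rel :: "'x rspace \<Rightarrow> 'x set \<Rightarrow> 'x set" where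
  "dia_rel X U = {x \<in> topspace (topo X). acc X `` {x} \<inter> U \<noteq> {}}"

definition usc :: "'x rspace \<Rightarrow> bool" where
  "usc X \<longleftrightarrow> (\<forall>U. openin (topo X) U \<longrightarrow> openin (topo X) (box_rel X U))"

definition lsc :: "'x rspace \<Rightarrow> bool" where
  "lsc X \<longleftrightarrow> (\<forall>U. openin (topo X) U \<longrightarrow> openin (topo X) (dia_rel X U))"

definition p_morphisms :: "'x rspace \<Rightarrow> 'y rspace \<Rightarrow> ('x \<Rightarrow> 'y) set" where
  "p_morphisms X Y = {f \<in> extensional (topspace (topo X)).
     continuous_map (topo X) (topo Y) f \<and>
     (\<forall>x x'. (x, x') \<in> acc X \<longrightarrow> (f x, f x') \<in> acc Y) \<and>
     (\<forall>U x y. openin (topo Y) U \<and> x \<in> topspace (topo X) \<and> (f x, y) \<in> acc Y \<and> y \<in> U \<longrightarrow>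
        (\<exists>x'. (x, x') \<in> acc X \<and> f x' \<in> U))}"

definition pq_morphisms :: "'x rspace \<Rightarrow> 'y rspace \<Rightarrow> ('x \<Rightarrow> 'y) set" where
  "pq_morphisms X Y = {f \<in> p_morphisms X Y.
     \<forall>U x y. openin (topo Y) U \<and> x \<in> topspace (topo X) \<and> (f x, y) \<in> acc Y \<and> y \<notin> U \<longrightarrow>
        (\<exists>x'. (x, x') \<in> acc X \<and> f x' \<notin> U)}"

datatype space_cat = RelSp | RelSp_l | RelSpq | RelSpq_l | RelSpq_u | RelSpq_c | EqSpq

definition sp_obj :: "space_cat \<Rightarrow> 'x rspace \<Rightarrow> bool" where
  "sp_obj D X \<longleftrightarrow> rel_space X \<and>
     (case D of
        RelSp \<Rightarrow> True
      | RelSp_l \<Rightarrow> lsc X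
      | RelSpq \<Rightarrow> True
      | RelSpq_l \<Rightarrow> lsc X
      | RelSpq_u \<Rightarrow> usc X
      | RelSpq_c \<Rightarrow> lsc X \<and> usc X
      | EqSpq \<Rightarrow> lsc X \<and> usc X \<and> equiv (topspace (topo X)) (acc X))"

definition sp_hom :: "space_cat \<Rightarrow> 'x rspace \<Rightarrow> 'y rspace \<Rightarrow> ('x \<Rightarrow> 'y) set" where
  "sp_hom D X Y = (if D \<in> {RelSp, RelSp_l} then p_morphisms X Y else pq_morphisms X Y)"

definition sp_id :: "'x rspace \<Rightarrow> 'x \<Rightarrow> 'x" where
  "sp_id X = (\<lambda>x\<in>topspace (topo X). x)"

definition sp_comp :: "'x rspace \<Rightarrow> ('y \<Rightarrow> 'z) \<Rightarrow> ('x \<Rightarrow> 'y) \<Rightarrow> 'x \<Rightarrow> 'z" where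
  "sp_comp X g f = compose (topspace (topo X)) g f"

definition sp_iso :: "space_cat \<Rightarrow> 'x rspace \<Rightarrow> 'y rspace \<Rightarrow> ('x \<Rightarrow> 'y) set" where
  "sp_iso D X Y = {f \<in> sp_hom D X Y.
     \<exists>g\<in>sp_hom D Y X. sp_comp X g f = sp_id X \<and> sp_comp Y f g = sp_id Y}"

section \<open>Modal frames\<close>

definition is_frame :: "('a, 'm) gorder_scheme \<Rightarrow> bool" where
  "is_frame A \<longleftrightarrow> complete_lattice A \<and>
     (\<forall>a\<in>carrier A. \<forall>S. S \<subseteq> carrier A \<longrightarrow> a \<sqinter>\<^bsub>A\<^esub> \<Squnion>\<^bsub>A\<^esub>S = \<Squnion>\<^bsub>A\<^esub>((\<lambda>s. a \<sqinter>\<^bsub>A\<^esub> s) ` S))"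

definition frame_morphisms ::
  "('a, 'm) gorder_scheme \<Rightarrow> ('b, 'n) gorder_scheme \<Rightarrow> ('a \<Rightarrow> 'b) set" where
  "frame_morphisms A B = {f \<in> carrier A \<rightarrow>\<^sub>E carrier B.
     f \<top>\<^bsub>A\<^esub> = \<top>\<^bsub>B\<^esub> \<and>
     (\<forall>a\<in>carrier A. \<forall>b\<in>carrier A. f (a \<sqinter>\<^bsub>A\<^esub> b) = f a \<sqinter>\<^bsub>B\<^esub> f b) \<and>
     (\<forall>S. S \<subseteq> carrier A \<longrightarrow> f (\<Squnion>\<^bsub>A\<^esub>S) = \<Squnion>\<^bsub>B\<^esub>(f ` S))}"

record 'a mframe = "'a gorder" +
  nec :: "'a \<Rightarrow> 'a"
  pos :: "'a \<Rightarrow> 'a"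

definition modal_frame :: "'a mframe \<Rightarrow> bool" where
  "modal_frame A \<longleftrightarrow> is_frame A \<and>
     nec A \<in> carrier A \<rightarrow> carrier A \<and> Mono\<^bsub>A\<^esub> (nec A) \<and>
     pos A \<in> carrier A \<rightarrow> carrier A \<and> Mono\<^bsub>A\<^esub> (pos A) \<and>
     \<top>\<^bsub>A\<^esub> \<sqsubseteq>\<^bsub>A\<^esub> nec A \<top>\<^bsub>A\<^esub> \<and>
     (\<forall>a\<in>carrier A. \<forall>b\<in>carrier A. nec A a \<sqinter>\<^bsub>A\<^esub> nec A b \<sqsubseteq>\<^bsub>A\<^esub> nec A (a \<sqinter>\<^bsub>A\<^esub> b)) \<and>
     (\<forall>a\<in>carrier A. \<forall>b\<in>carrier A. nec A a \<sqinter>\<^bsub>A\<^esub> pos A b \<sqsubseteq>\<^bsub>A\<^esub> pos A (a \<sqinter>\<^bsub>A\<^esub> b)) \<and>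
     pos A \<bottom>\<^bsub>A\<^esub> \<sqsubseteq>\<^bsub>A\<^esub> \<bottom>\<^bsub>A\<^esub>"

definition equivalence_frame :: "'a mframe \<Rightarrow> bool" where
  "equivalence_frame A \<longleftrightarrow> modal_frame A \<and>
     (\<forall>a\<in>carrier A.
        nec A a \<sqsubseteq>\<^bsub>A\<^esub> a \<and> a \<sqsubseteq>\<^bsub>A\<^esub> pos A a \<and>
        nec A a \<sqsubseteq>\<^bsub>A\<^esub> nec A (nec A a) \<and> pos A (pos A a) \<sqsubseteq>\<^bsub>A\<^esub> pos A a \<and>
        pos A (nec A a) \<sqsubseteq>\<^bsub>A\<^esub> a \<and> a \<sqsubseteq>\<^bsub>A\<^esub> nec A (pos A a))"

definition mf_morphisms :: "'a mframe \<Rightarrow> 'b mframe \<Rightarrow> ('a \<Rightarrow> 'b) set" where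
  "mf_morphisms A B = {f \<in> frame_morphisms A B.
     \<forall>a\<in>carrier A. f (nec A a) \<sqsubseteq>\<^bsub>B\<^esub> nec B (f a) \<and> f (pos A a) \<sqsubseteq>\<^bsub>B\<^esub> pos B (f a)}"

definition box_strict :: "'a mframe \<Rightarrow> 'b mframe \<Rightarrow> ('a \<Rightarrow> 'b) \<Rightarrow> bool" where
  "box_strict A B f \<longleftrightarrow> (\<forall>a\<in>carrier A. f (nec A a) = nec B (f a))"

definition dia_strict :: "'a mframe \<Rightarrow> 'b mframe \<Rightarrow> ('a \<Rightarrow> 'b) \<Rightarrow> bool" where
  "dia_strict A B f \<longleftrightarrow> (\<forall>a\<in>carrier A. f (pos A a) = pos B (f a))"

datatype frame_cat = MFrm | MFrm_box | MFrm_dia | MFrm_box_dia | EqFrm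

definition fr_obj :: "frame_cat \<Rightarrow> 'a mframe \<Rightarrow> bool" where
  "fr_obj C A \<longleftrightarrow> (if C = EqFrm then equivalence_frame A else modal_frame A)"

definition fr_hom :: "frame_cat \<Rightarrow> 'a mframe \<Rightarrow> 'b mframe \<Rightarrow> ('a \<Rightarrow> 'b) set" where
  "fr_hom C A B = {f \<in> mf_morphisms A B.
     case C of
       MFrm \<Rightarrow> True
     | MFrm_box \<Rightarrow> box_strict A B f
     | MFrm_dia \<Rightarrow> dia_strict A B f
     | MFrm_box_dia \<Rightarrow> box_strict A B f \<and> dia_strict A B f
     | EqFrm \<Rightarrow> box_strict A B f \<and> dia_strict A B f}"

definition fr_id :: "'a mframe \<Rightarrow> 'a \<Rightarrow> 'a" where
  "fr_id A = (\<lambda>a\<in>carrier A. a)"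

definition fr_comp :: "'a mframe \<Rightarrow> ('b \<Rightarrow> 'c) \<Rightarrow> ('a \<Rightarrow> 'b) \<Rightarrow> 'a \<Rightarrow> 'c" where
  "fr_comp A g f = compose (carrier A) g f"

definition fr_iso :: "frame_cat \<Rightarrow> 'a mframe \<Rightarrow> 'b mframe \<Rightarrow> ('a \<Rightarrow> 'b) set" where
  "fr_iso C A B = {f \<in> fr_hom C A B.
     \<exists>g\<in>fr_hom C B A. fr_comp A g f = fr_id A \<and> fr_comp B f g = fr_id B}"

section \<open>From spaces to frames\<close>

definition Omega :: "'x rspace \<Rightarrow> 'x set mframe" where
  "Omega X = \<lparr>carrier = {U. openin (topo X) U}, eq = (=), le = (\<subseteq>),
     nec = (\<lambda>U. topo X interior_of box_rel X U),
     pos = (\<lambda>U. topo X interior_of dia_rel X U)\<rparr>"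

definition Omega_mor :: "'x rspace \<Rightarrow> 'y rspace \<Rightarrow> ('x \<Rightarrow> 'y) \<Rightarrow> 'y set \<Rightarrow> 'x set" where
  "Omega_mor X Y f = (\<lambda>U\<in>carrier (Omega Y). f -` U \<inter> topspace (topo X))"

section \<open>From frames to spaces\<close>

definition two :: "bool gorder" where
  "two = \<lparr>carrier = UNIV, eq = (=), le = (\<le>)\<rparr>"

definition characters :: "'a mframe \<Rightarrow> ('a \<Rightarrow> bool) set" where
  "characters A = frame_morphisms A two"

definition is_filter :: "'a mframe \<Rightarrow> 'a set \<Rightarrow> bool" where
  "is_filter A F \<longleftrightarrow> F \<subseteq> carrier A \<and> F \<noteq> {} \<and>
     (\<forall>a\<in>F. \<forall>b\<in>carrier A. a \<sqsubseteq>\<^bsub>A\<^esub> b \<longrightarrow> b \<in> F) \<and>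
     (\<forall>a\<in>F. \<forall>b\<in>F. a \<sqinter>\<^bsub>A\<^esub> b \<in> F)"

definition char_filter :: "'a mframe \<Rightarrow> ('a \<Rightarrow> bool) \<Rightarrow> 'a set" where
  "char_filter A p = {c \<in> carrier A. p (nec A c)}"

text \<open>A single type for the pairs $(p,a)$ and the triples $(p,a,F)$.\<close>

datatype 'a pt =
  Pt2 (ch: "'a \<Rightarrow> bool") (av: 'a)
| Pt3 (ch: "'a \<Rightarrow> bool") (av: 'a) (fl: "'a set")

definition pre_pairs :: "'a mframe \<Rightarrow> 'a pt set" where
  "pre_pairs A = {Pt2 p a | p a. p \<in> characters A \<and> a \<in> carrier A \<and> \<not> p (pos A a)}"

definition pre_triples :: "'a mframe \<Rightarrow> 'a pt set" where
  "pre_triples A = {Pt3 p a F | p a F. p \<in> characters A \<and> a \<in> carrier A \<and> is_filter A F \<and>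
     \<not> p (pos A a) \<and> char_filter A p \<subseteq> F}"

definition largest_avoid :: "'a mframe \<Rightarrow> 'a pt \<Rightarrow> bool" where
  "largest_avoid A x \<longleftrightarrow> (\<forall>c\<in>carrier A. \<not> ch x (pos A c) \<longrightarrow> c \<sqsubseteq>\<^bsub>A\<^esub> av x)"

definition least_filter :: "'a mframe \<Rightarrow> 'a pt \<Rightarrow> bool" where
  "least_filter A x \<longleftrightarrow> fl x \<subseteq> char_filter A (ch x)"

definition prepoints :: "space_cat \<Rightarrow> 'a mframe \<Rightarrow> 'a pt set" where
  "prepoints D A =
     (case D of
        RelSp \<Rightarrow> pre_pairs A
      | RelSp_l \<Rightarrow> {x \<in> pre_pairs A. largest_avoid A x}
      | RelSpq \<Rightarrow> pre_triples A
      | RelSpq_l \<Rightarrow> {x \<in> pre_triples A. largest_avoid A x}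
      | RelSpq_u \<Rightarrow> {x \<in> pre_triples A. least_filter A x}
      | RelSpq_c \<Rightarrow> {x \<in> pre_triples A. largest_avoid A x \<and> least_filter A x}
      | EqSpq \<Rightarrow> {x \<in> pre_triples A. largest_avoid A x \<and> least_filter A x})"

fun pt_rel :: "'a mframe \<Rightarrow> 'a pt \<Rightarrow> 'a pt \<Rightarrow> bool" where
  "pt_rel A (Pt2 p a) (Pt2 q b) \<longleftrightarrow> \<not> q a \<and> (\<forall>c\<in>carrier A. p (nec A c) \<longrightarrow> q c)"
| "pt_rel A (Pt3 p a F) (Pt3 q b G) \<longleftrightarrow> \<not> q a \<and> (\<forall>c\<in>F. q c)"
| "pt_rel A (Pt2 p a) (Pt3 q b G) \<longleftrightarrow> False"
| "pt_rel A (Pt3 p a F) (Pt2 q b) \<longleftrightarrow> False"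

definition dia_witnessed :: "'a mframe \<Rightarrow> 'a pt set \<Rightarrow> bool" where
  "dia_witnessed A S \<longleftrightarrow>
     (\<forall>x\<in>S. \<forall>c\<in>carrier A. \<not> c \<sqsubseteq>\<^bsub>A\<^esub> av x \<longrightarrow> (\<exists>y\<in>S. pt_rel A x y \<and> ch y c))"

definition box_witnessed :: "'a mframe \<Rightarrow> 'a pt set \<Rightarrow> bool" where
  "box_witnessed A S \<longleftrightarrow>
     (\<forall>p a F. Pt3 p a F \<in> S \<longrightarrow>
        (\<forall>c\<in>carrier A. c \<notin> F \<longrightarrow> (\<exists>y\<in>S. pt_rel A (Pt3 p a F) y \<and> \<not> ch y c)))"

definition points :: "space_cat \<Rightarrow> 'a mframe \<Rightarrow> 'a pt set" where
  "points D A = \<Union>{S. S \<subseteq> prepoints D A \<and> dia_witnessed A S \<and> box_witnessed A S}"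


lemma points_largest:
  shows "points D A \<subseteq> prepoints D A" "dia_witnessed A (points D A)" "box_witnessed A (points D A)"
    and "S \<subseteq> prepoints D A \<Longrightarrow> dia_witnessed A S \<Longrightarrow> box_witnessed A S \<Longrightarrow> S \<subseteq> points D A"
proof -
  show "points D A \<subseteq> prepoints D A"
    unfolding points_def by blast
  show "dia_witnessed A (points D A)"
    unfolding dia_witnessed_def
  proof (intro ballI impI)
    fix x c assume "x \<in> points D A" and c: "c \<in> carrier A" "\<not> c \<sqsubseteq>\<^bsub>A\<^esub> av x"
    then obtain S where S: "S \<subseteq> prepoints D A" "dia_witnessed A S" "box_witnessed A S" "x \<in> S"
      unfolding points_def by blast
    then have "S \<subseteq> points D A" unfolding points_def by blast
    moreover have "\<exists>y\<in>S. pt_rel A x y \<and> ch y c"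
      using S c unfolding dia_witnessed_def by blast
    ultimately show "\<exists>y\<in>points D A. pt_rel A x y \<and> ch y c" by blast
  qed
  show "box_witnessed A (points D A)"
    unfolding box_witnessed_def
  proof (intro allI ballI impI)
    fix p a F c assume "Pt3 p a F \<in> points D A" and c: "c \<in> carrier A" "c \<notin> F"
    then obtain S where S: "S \<subseteq> prepoints D A" "dia_witnessed A S" "box_witnessed A S" "Pt3 p a F \<in> S"
      unfolding points_def by blast
    then have "S \<subseteq> points D A" unfolding points_def by blast
    moreover have "\<exists>y\<in>S. pt_rel A (Pt3 p a F) y \<and> \<not> ch y c"
      using S c unfolding box_witnessed_def by blast
    ultimately show "\<exists>y\<in>points D A. pt_rel A (Pt3 p a F) y \<and> \<not> ch y c" by blast
  qed
  show "S \<subseteq> points D A" if "S \<subseteq> prepoints D A" "dia_witnessed A S" "box_witnessed A S"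
    using that unfolding points_def by blast
qed

definition phi :: "space_cat \<Rightarrow> 'a mframe \<Rightarrow> 'a \<Rightarrow> 'a pt set" where
  "phi D A c = {x \<in> points D A. ch x c}"

definition Fsp :: "space_cat \<Rightarrow> 'a mframe \<Rightarrow> 'a pt rspace" where
  "Fsp D A = \<lparr>topo = topology (\<lambda>U. U \<in> phi D A ` carrier A),
     acc = {(x, y). x \<in> points D A \<and> y \<in> points D A \<and> pt_rel A x y}\<rparr>"

lemma ch_character:
  assumes "x \<in> points D A"
  shows "ch x \<in> characters A"
proof -
  have "x \<in> prepoints D A" using assms points_largest(1) by blast
  then have "x \<in> pre_pairs A \<or> x \<in> pre_triples A"
    by (simp add: prepoints_def split: space_cat.splits)
  then show ?thesis by (auto simp: pre_pairs_def pre_triples_def)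
qed

lemma meet_two: "a \<sqinter>\<^bsub>two\<^esub> b \<longleftrightarrow> a \<and> b"
proof -
  have "greatest two x (Lower two {a, b}) \<longleftrightarrow> x = (a \<and> b)" for x
    by (cases a; cases b; cases x) (auto simp: greatest_def Lower_def two_def)
  then show ?thesis by (simp add: meet_def inf_def)
qed

lemma sup_two: "\<Squnion>\<^bsub>two\<^esub>S \<longleftrightarrow> True \<in> S"
proof -
  have U: "Upper two S = {u. True \<in> S \<longrightarrow> u}"
    unfolding Upper_def two_def by fastforce
  have "least two x (Upper two S) \<longleftrightarrow> x = (True \<in> S)" for x
    unfolding least_def U by (cases x; cases "True \<in> S") (simp_all add: two_def ex_bool_eq)
  then show ?thesis by (simp add: sup_def)
qed

lemma openin_Fsp:
  assumes "modal_frame A"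
  shows "openin (topo (Fsp D A)) U \<longleftrightarrow> U \<in> phi D A ` carrier A"
proof -
  interpret complete_lattice A
    using assms by (simp add: modal_frame_def is_frame_def)
  have ch: "ch x \<in> frame_morphisms A two" if "x \<in> points D A" for x
    using ch_character[OF that] by (simp add: characters_def)
  have meet: "phi D A (a \<sqinter>\<^bsub>A\<^esub> b) = phi D A a \<inter> phi D A b"
    if ab: "a \<in> carrier A" "b \<in> carrier A" for a b
  proof -
    have "ch x (a \<sqinter>\<^bsub>A\<^esub> b) \<longleftrightarrow> ch x a \<and> ch x b" if "x \<in> points D A" for x
      using ch[OF that] ab by (simp add: frame_morphisms_def meet_two)
    then show ?thesis unfolding phi_def by blast
  qed
  have sup: "phi D A (\<Squnion>\<^bsub>A\<^esub>S) = \<Union>(phi D A ` S)" if S: "S \<subseteq> carrier A" for S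
  proof -
    have "ch x (\<Squnion>\<^bsub>A\<^esub>S) \<longleftrightarrow> (\<exists>c\<in>S. ch x c)" if "x \<in> points D A" for x
    proof -
      have "ch x (\<Squnion>\<^bsub>A\<^esub>S) = \<Squnion>\<^bsub>two\<^esub>(ch x ` S)"
        using ch[OF that] S by (simp add: frame_morphisms_def)
      then show ?thesis by (auto simp: sup_two)
    qed
    then show ?thesis unfolding phi_def by blast
  qed
  have "istopology (\<lambda>U. U \<in> phi D A ` carrier A)"
    unfolding istopology_def
  proof (intro conjI allI impI)
    fix U V assume "U \<in> phi D A ` carrier A" "V \<in> phi D A ` carrier A"
    then obtain a b where "a \<in> carrier A" "b \<in> carrier A" "U = phi D A a" "V = phi D A b" by blast
    then show "U \<inter> V \<in> phi D A ` carrier A"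
      using meet[of a b] meet_closed[of a b] by blast
  next
    fix K assume "\<forall>U\<in>K. U \<in> phi D A ` carrier A"
    then have "K \<subseteq> phi D A ` carrier A" by (simp add: subset_eq)
    then obtain S where S: "S \<subseteq> carrier A" "K = phi D A ` S"
      unfolding subset_image_iff by (elim exE conjE)
    then have "\<Union>K = phi D A (\<Squnion>\<^bsub>A\<^esub>S)" by (simp only: sup)
    moreover have "\<Squnion>\<^bsub>A\<^esub>S \<in> carrier A" using S(1) by (rule sup_closed)
    ultimately show "\<Union>K \<in> phi D A ` carrier A" by (rule image_eqI)
  qed
  then show ?thesis by (simp add: Fsp_def)
qed

definition Fsp_mor ::
  "space_cat \<Rightarrow> 'a mframe \<Rightarrow> 'b mframe \<Rightarrow> ('a \<Rightarrow> 'b) \<Rightarrow> 'b pt \<Rightarrow> 'a pt" where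
  "Fsp_mor D A B f = (\<lambda>x\<in>points D B.
     (let p = (\<lambda>c\<in>carrier A. ch x (f c));
          a = \<Squnion>\<^bsub>A\<^esub>{c \<in> carrier A. f c \<sqsubseteq>\<^bsub>B\<^esub> av x}
      in case x of
           Pt2 q b \<Rightarrow> Pt2 p a
         | Pt3 q b G \<Rightarrow> Pt3 p a {c \<in> carrier A. f c \<in> G}))"

section \<open>Unit and counit\<close>

definition phi_map :: "space_cat \<Rightarrow> 'a mframe \<Rightarrow> 'a \<Rightarrow> 'a pt set" where
  "phi_map D A = (\<lambda>c\<in>carrier A. phi D A c)"

text \<open>
  A point $x$ of a space gives the character ``$x$ belongs to $U$'', the largest open set
  disjoint from the successors of $x$, and the filter of open sets containing all successors.
\<close>

definition eta :: "space_cat \<Rightarrow> 'x rspace \<Rightarrow> 'x \<Rightarrow> 'x set pt" where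
  "eta D X = (\<lambda>x\<in>topspace (topo X).
     (let p = (\<lambda>U\<in>carrier (Omega X). x \<in> U);
          a = \<Union>{U. openin (topo X) U \<and> acc X `` {x} \<inter> U = {}};
          F = {U. openin (topo X) U \<and> acc X `` {x} \<subseteq> U}
      in if D \<in> {RelSp, RelSp_l} then Pt2 p a else Pt3 p a F))"

section \<open>The pairs of categories and the images of the functors\<close>

text \<open>
  For lower-semicontinuous spaces the frame side must have diamond-strict morphisms, also with
  p-morphisms: \<^const>\<open>Omega_mor\<close> is then always diamond-strict, and if \<open>f\<close> is not, then
  \<^const>\<open>Fsp_mor\<close> need not preserve \<^const>\<open>largest_avoid\<close>. Hence the partner of \<^const>\<open>RelSp_l\<close> is
  \<^const>\<open>MFrm_dia\<close> and not \<^const>\<open>MFrm\<close>.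
\<close>

definition dual_pairs :: "(frame_cat \<times> space_cat) set" where
  "dual_pairs =
     {(MFrm, RelSp), (MFrm_dia, RelSp_l), (MFrm, RelSpq), (MFrm_dia, RelSpq_l),
      (MFrm_box, RelSpq_u), (MFrm_box_dia, RelSpq_c), (EqFrm, EqSpq)}"

definition Omega_image :: "space_cat \<Rightarrow> 'x set mframe set" where
  "Omega_image D = Omega ` {X. sp_obj D X}"

definition Fsp_image :: "frame_cat \<Rightarrow> space_cat \<Rightarrow> 'a pt rspace set" where
  "Fsp_image C D = Fsp D ` {A. fr_obj C A}"

text \<open>
  The objects of either category live in arbitrary types, so no HOL term denotes the whole
  category. For types \<open>'x\<close> and \<open>'a\<close>, \<^term>\<open>Omega_image D :: 'x set mframe set\<close> and
  \<^term>\<open>Fsp_image C D :: 'a pt rspace set\<close> are the objects of the two full subcategories that come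
  from structures over \<open>'x\<close> and \<open>'a\<close>; the hom sets \<^const>\<open>fr_hom\<close> and \<^const>\<open>sp_hom\<close> relate
  structures over different types. A duality between the subcategories is given by the two
  contravariant functors \<^const>\<open>Fsp\<close> and \<^const>\<open>Omega\<close> with the natural isomorphisms
  \<^const>\<open>phi_map\<close> and \<^const>\<open>eta\<close>, with all objects ranging over all types independently.
\<close>

end

theory Submission
  imports Defs
begin

text \<open>
  In the space of points of \<open>A\<close> the two witnessing conditions say exactly that, at a point with
  components $(p,a,F)$, the set \<^term>\<open>phi D A c\<close> misses all successors iff $c\le a$ and contains all
  successors iff $c\in F$ (for triples). In an arbitrary space the point \<^term>\<open>eta D X x\<close> has the same property
  with respect to the open sets. Hence \<^const>\<open>phi_map\<close> and \<^const>\<open>eta\<close> are morphisms on all objects,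
  natural, and satisfy the triangle identities of a dual adjunction. \<^const>\<open>Omega_mor\<close> of
  \<open>eta D X\<close> is inverse to \<^const>\<open>phi_map\<close> on \<^term>\<open>Omega X\<close>, and \<^const>\<open>Fsp_mor\<close> of
  \<open>phi_map D A\<close>, which is injective, is inverse to \<^const>\<open>eta\<close> on \<^term>\<open>Fsp D A\<close>.
\<close>

section \<open>Frames and characters\<close>

text \<open>\<open>points D A\<close> is a greatest fixed point, so membership is obtained for whole
  sets at once: the image of all points under \<open>Fsp_mor\<close>, or of a whole space under
  \<open>eta\<close>, is closed under witnesses because images of witnesses are witnesses.
  Afterwards a point \<open>x\<close> is handled mainly through three tests on elements
  \<open>c\<close> of the frame: \<open>ch x c\<close>, whether \<open>c\<close> lies below
  \<open>av x\<close>, and whether \<open>c\<close> lies in \<open>filt A x\<close>.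
  \<open>Fsp_mor\<close> and \<open>eta\<close> turn these tests at an image into tests at the
  original point, which settles equality of points, functoriality and naturality.
  \<open>phi_map D A\<close> need not be injective, since a frame may have too few points, but it is
  onto the open sets: \<open>Fsp D A\<close> has no open sets other than the
  \<open>phi D A c\<close>. Hence a point over \<open>Omega (Fsp D A)\<close> is known once its
  tests on the sets \<open>phi D A c\<close> are known, and its image under \<open>Fsp_mor\<close>
  of \<open>phi_map D A\<close> records exactly these; whence the injectivity. The seven cases
  differ in three switches, \<open>triples\<close>, \<open>lower\<close> and \<open>upper\<close>,
  and in the equivalence axioms, which concern objects alone.\<close>

lemma is_frame_complete_lattice: "is_frame A \<Longrightarrow> complete_lattice A"
  by (simp add: is_frame_def)

lemma modal_frame_is_frame: "modal_frame A \<Longrightarrow> is_frame A"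
  by (simp add: modal_frame_def)

lemma modal_frame_complete_lattice: "modal_frame A \<Longrightarrow> complete_lattice A"
  by (simp add: modal_frame_def is_frame_def)

lemma nec_closed: "modal_frame A \<Longrightarrow> a \<in> carrier A \<Longrightarrow> nec A a \<in> carrier A"
  by (auto simp: modal_frame_def)

lemma pos_closed: "modal_frame A \<Longrightarrow> a \<in> carrier A \<Longrightarrow> pos A a \<in> carrier A"
  by (auto simp: modal_frame_def)

lemma nec_mono:
  "modal_frame A \<Longrightarrow> a \<in> carrier A \<Longrightarrow> b \<in> carrier A \<Longrightarrow> a \<sqsubseteq>\<^bsub>A\<^esub> b \<Longrightarrow> nec A a \<sqsubseteq>\<^bsub>A\<^esub> nec A b"
  by (auto simp: modal_frame_def isotone_def)

lemma pos_mono: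
  "modal_frame A \<Longrightarrow> a \<in> carrier A \<Longrightarrow> b \<in> carrier A \<Longrightarrow> a \<sqsubseteq>\<^bsub>A\<^esub> b \<Longrightarrow> pos A a \<sqsubseteq>\<^bsub>A\<^esub> pos A b"
  by (auto simp: modal_frame_def isotone_def)

lemma frame_morphism_closed: "f \<in> frame_morphisms A B \<Longrightarrow> a \<in> carrier A \<Longrightarrow> f a \<in> carrier B"
  by (auto simp: frame_morphisms_def)

lemma frame_morphism_meet:
  "f \<in> frame_morphisms A B \<Longrightarrow> a \<in> carrier A \<Longrightarrow> b \<in> carrier A \<Longrightarrow>
    f (a \<sqinter>\<^bsub>A\<^esub> b) = f a \<sqinter>\<^bsub>B\<^esub> f b"
  by (auto simp: frame_morphisms_def)

lemma frame_morphism_sup: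
  "f \<in> frame_morphisms A B \<Longrightarrow> S \<subseteq> carrier A \<Longrightarrow> f (\<Squnion>\<^bsub>A\<^esub>S) = \<Squnion>\<^bsub>B\<^esub>(f ` S)"
  by (auto simp: frame_morphisms_def)

text \<open>Turns order into an equation, so that monotonicity of frame morphisms and of characters
  follows from preservation of meets.\<close>

lemma complete_lattice_le_iff_meet:
  assumes "complete_lattice A" "a \<in> carrier A" "b \<in> carrier A"
  shows "a \<sqsubseteq>\<^bsub>A\<^esub> b \<longleftrightarrow> a \<sqinter>\<^bsub>A\<^esub> b = a"
proof -
  interpret complete_lattice A by fact
  show ?thesis using assms(2,3)
    by (metis le_antisym le_refl meet_closed meet_le meet_left meet_right)
qed

lemma frame_morphism_mono:
  assumes "is_frame A" "is_frame B" and f: "f \<in> frame_morphisms A B"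
    and ab: "a \<in> carrier A" "b \<in> carrier A" "a \<sqsubseteq>\<^bsub>A\<^esub> b"
  shows "f a \<sqsubseteq>\<^bsub>B\<^esub> f b"
proof -
  note cl = is_frame_complete_lattice[OF assms(1)] is_frame_complete_lattice[OF assms(2)]
  have "f a = f (a \<sqinter>\<^bsub>A\<^esub> b)" using complete_lattice_le_iff_meet[OF cl(1)] ab by simp
  then show ?thesis
    using complete_lattice_le_iff_meet[OF cl(2)] frame_morphism_meet[OF f] frame_morphism_closed[OF f] ab
    by simp
qed

lemma frame_morphism_id:
  assumes "is_frame A"
  shows "(\<lambda>a\<in>carrier A. a) \<in> frame_morphisms A A"
proof -
  interpret complete_lattice A by (rule is_frame_complete_lattice[OF assms])
  have "(\<lambda>a\<in>carrier A. a) ` S = S" if "S \<subseteq> carrier A" for S using that by force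
  then show ?thesis by (auto simp: frame_morphisms_def)
qed

lemma frame_morphism_compose:
  assumes "is_frame A" and f: "f \<in> frame_morphisms A B" and g: "g \<in> frame_morphisms B E"
  shows "compose (carrier A) g f \<in> frame_morphisms A E"
proof -
  interpret A: complete_lattice A by (rule is_frame_complete_lattice[OF assms(1)])
  have "compose (carrier A) g f (\<Squnion>\<^bsub>A\<^esub>S) = \<Squnion>\<^bsub>E\<^esub>(compose (carrier A) g f ` S)"
    if S: "S \<subseteq> carrier A" for S
  proof -
    have "f ` S \<subseteq> carrier B" using S f by (auto simp: frame_morphisms_def)
    moreover have "compose (carrier A) g f ` S = g ` f ` S"
      using S by (force simp: compose_def image_iff)
    ultimately show ?thesis using f g S by (simp add: compose_def frame_morphism_sup)
  qed
  then show ?thesis using f g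
    by (auto simp: frame_morphisms_def compose_def PiE_iff)
qed

section \<open>Characters, filters and right adjoints\<close>

lemma top_two: "\<top>\<^bsub>two\<^esub>"
proof -
  have "greatest two x (carrier two) \<longleftrightarrow> x" for x
    by (cases x) (auto simp: greatest_def two_def)
  then show ?thesis using someI[of "\<lambda>x. x" True] by (simp add: top_def)
qed

text \<open>Removes the lattice \<open>two\<close> from later arguments: a character is treated as a
  completely prime filter given by its truth values.\<close>

lemma character_iff:
  "p \<in> characters A \<longleftrightarrow> p \<in> extensional (carrier A) \<and> p \<top>\<^bsub>A\<^esub> \<and>
    (\<forall>a\<in>carrier A. \<forall>b\<in>carrier A. p (a \<sqinter>\<^bsub>A\<^esub> b) \<longleftrightarrow> p a \<and> p b) \<and>
    (\<forall>S. S \<subseteq> carrier A \<longrightarrow> (p (\<Squnion>\<^bsub>A\<^esub>S) \<longleftrightarrow> (\<exists>s\<in>S. p s)))"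
proof -
  have UNIV: "carrier two = UNIV" by (simp add: two_def)
  have "p (\<Squnion>\<^bsub>A\<^esub>S) = \<Squnion>\<^bsub>two\<^esub>(p ` S) \<longleftrightarrow> (p (\<Squnion>\<^bsub>A\<^esub>S) \<longleftrightarrow> (\<exists>s\<in>S. p s))" for S
    unfolding sup_two by (metis (full_types) image_iff)
  then show ?thesis
    unfolding characters_def frame_morphisms_def PiE_def UNIV Pi_UNIV
    by (simp add: meet_two top_two)
qed

lemma character_meet:
  "p \<in> characters A \<Longrightarrow> a \<in> carrier A \<Longrightarrow> b \<in> carrier A \<Longrightarrow> p (a \<sqinter>\<^bsub>A\<^esub> b) \<longleftrightarrow> p a \<and> p b"
  by (simp add: character_iff)

lemma character_mono:
  assumes "modal_frame A" "p \<in> characters A" "a \<in> carrier A" "b \<in> carrier A" "a \<sqsubseteq>\<^bsub>A\<^esub> b" "p a"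
  shows "p b"
  using assms character_meet[OF assms(2-4)]
    complete_lattice_le_iff_meet[OF modal_frame_complete_lattice[OF assms(1)] assms(3,4)]
  by simp

lemma character_comp:
  assumes "is_frame A" "f \<in> frame_morphisms A B" "q \<in> characters B"
  shows "(\<lambda>c\<in>carrier A. q (f c)) \<in> characters A"
  using frame_morphism_compose[OF assms(1,2)] assms(3) by (simp add: characters_def compose_def)

text \<open>The axioms of \<open>nec\<close> for top and binary meets, together with its
  monotonicity, give nonemptiness, closure under meets and up-closure. This is what allows a pair to
  be read as a triple with this filter.\<close>

lemma is_filter_char_filter:
  assumes A: "modal_frame A" and p: "p \<in> characters A"
  shows "is_filter A (char_filter A p)"
proof -
  interpret complete_lattice A by (rule modal_frame_complete_lattice[OF A])
  note [simp] = nec_closed[OF A]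
  have "p (nec A \<top>\<^bsub>A\<^esub>)"
    using A p character_mono[OF A p, of "\<top>\<^bsub>A\<^esub>" "nec A \<top>\<^bsub>A\<^esub>"]
    by (simp add: modal_frame_def character_iff)
  moreover have "p (nec A (a \<sqinter>\<^bsub>A\<^esub> b))"
    if "a \<in> carrier A" "b \<in> carrier A" "p (nec A a)" "p (nec A b)" for a b
    using A that character_meet[OF p, of "nec A a" "nec A b"]
      character_mono[OF A p, of "nec A a \<sqinter>\<^bsub>A\<^esub> nec A b" "nec A (a \<sqinter>\<^bsub>A\<^esub> b)"]
    by (simp add: modal_frame_def)
  moreover have "p (nec A b)" if "a \<in> carrier A" "b \<in> carrier A" "p (nec A a)" "a \<sqsubseteq>\<^bsub>A\<^esub> b" for a b
    using that character_mono[OF A p, of "nec A a" "nec A b"] nec_mono[OF A] by simp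
  ultimately show ?thesis
    by (auto simp: is_filter_def char_filter_def)
qed

lemma is_filter_vimage:
  assumes A: "is_frame A" and B: "is_frame B" and f: "f \<in> frame_morphisms A B" and G: "is_filter B G"
  shows "is_filter A {c \<in> carrier A. f c \<in> G}"
proof -
  have "\<top>\<^bsub>A\<^esub> \<in> {c \<in> carrier A. f c \<in> G}"
  proof -
    interpret A: complete_lattice A by (rule is_frame_complete_lattice[OF A])
    interpret B: complete_lattice B by (rule is_frame_complete_lattice[OF B])
    obtain g where "g \<in> G" "g \<in> carrier B" using G unfolding is_filter_def by blast
    then have "\<top>\<^bsub>B\<^esub> \<in> G" using G B.top_higher B.top_closed unfolding is_filter_def by blast
    moreover have "f \<top>\<^bsub>A\<^esub> = \<top>\<^bsub>B\<^esub>" using f by (simp add: frame_morphisms_def)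
    ultimately show ?thesis by simp
  qed
  then have "{c \<in> carrier A. f c \<in> G} \<noteq> {}" by blast
  moreover have "b \<in> {c \<in> carrier A. f c \<in> G}"
    if "a \<in> {c \<in> carrier A. f c \<in> G}" "b \<in> carrier A" "a \<sqsubseteq>\<^bsub>A\<^esub> b" for a b
    using that G frame_morphism_mono[OF A B f] frame_morphism_closed[OF f]
    unfolding is_filter_def by blast
  moreover have "a \<sqinter>\<^bsub>A\<^esub> b \<in> {c \<in> carrier A. f c \<in> G}"
    if "a \<in> {c \<in> carrier A. f c \<in> G}" "b \<in> {c \<in> carrier A. f c \<in> G}" for a b
  proof -
    interpret A: complete_lattice A by (rule is_frame_complete_lattice[OF A])
    show ?thesis using that G by (simp add: is_filter_def frame_morphism_meet[OF f])
  qed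
  ultimately show ?thesis
    unfolding is_filter_def by (intro conjI ballI impI) (assumption | blast)+
qed

text \<open>The right adjoint of a frame morphism \<open>f\<close>, evaluated at \<open>b\<close>.\<close>

lemma le_sup_iff:
  assumes A: "is_frame A" and B: "is_frame B" and f: "f \<in> frame_morphisms A B"
    and b: "b \<in> carrier B" and c: "c \<in> carrier A"
  shows "c \<sqsubseteq>\<^bsub>A\<^esub> \<Squnion>\<^bsub>A\<^esub>{c \<in> carrier A. f c \<sqsubseteq>\<^bsub>B\<^esub> b} \<longleftrightarrow> f c \<sqsubseteq>\<^bsub>B\<^esub> b"
proof -
  interpret A: complete_lattice A by (rule is_frame_complete_lattice[OF A])
  interpret B: complete_lattice B by (rule is_frame_complete_lattice[OF B])
  let ?S = "{c \<in> carrier A. f c \<sqsubseteq>\<^bsub>B\<^esub> b}"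
  have S: "?S \<subseteq> carrier A" by auto
  \<comment> \<open>The supremum belongs to its own defining set, because \<open>f\<close> preserves
    suprema.\<close>
  have "f (\<Squnion>\<^bsub>A\<^esub>?S) = \<Squnion>\<^bsub>B\<^esub>(f ` ?S)" by (rule frame_morphism_sup[OF f S])
  also have "\<dots> \<sqsubseteq>\<^bsub>B\<^esub> b" using frame_morphism_closed[OF f] b by (intro B.sup_least) auto
  finally have le: "f (\<Squnion>\<^bsub>A\<^esub>?S) \<sqsubseteq>\<^bsub>B\<^esub> b" .
  show ?thesis
  proof
    assume "c \<sqsubseteq>\<^bsub>A\<^esub> \<Squnion>\<^bsub>A\<^esub>?S"
    then have "f c \<sqsubseteq>\<^bsub>B\<^esub> f (\<Squnion>\<^bsub>A\<^esub>?S)" using frame_morphism_mono[OF A B f c] A.sup_closed[OF S] by blast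
    then show "f c \<sqsubseteq>\<^bsub>B\<^esub> b"
      by (rule B.le_trans[OF _ le])
        (rule frame_morphism_closed[OF f] c b A.sup_closed[OF S])+
  next
    assume "f c \<sqsubseteq>\<^bsub>B\<^esub> b"
    then show "c \<sqsubseteq>\<^bsub>A\<^esub> \<Squnion>\<^bsub>A\<^esub>?S" using A.sup_upper[OF S] c by blast
  qed
qed

lemma frame_eqI:
  assumes "is_frame A" "a \<in> carrier A" "b \<in> carrier A"
    and "\<And>c. c \<in> carrier A \<Longrightarrow> c \<sqsubseteq>\<^bsub>A\<^esub> a \<longleftrightarrow> c \<sqsubseteq>\<^bsub>A\<^esub> b"
  shows "a = b"
proof -
  interpret complete_lattice A by (rule is_frame_complete_lattice[OF assms(1)])
  show ?thesis using assms by blast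
qed

section \<open>The frame of open sets\<close>

lemma carrier_Omega [simp]: "carrier (Omega X) = {U. openin (topo X) U}"
  and le_Omega [simp]: "U \<sqsubseteq>\<^bsub>Omega X\<^esub> V \<longleftrightarrow> U \<subseteq> V"
  and nec_Omega [simp]: "nec (Omega X) U = topo X interior_of box_rel X U"
  and pos_Omega [simp]: "pos (Omega X) U = topo X interior_of dia_rel X U"
  by (simp_all add: Omega_def)

lemma partial_order_Omega: "partial_order (Omega X)"
  by unfold_locales (auto simp: Omega_def)

lemma least_Omega: "S \<subseteq> carrier (Omega X) \<Longrightarrow> least (Omega X) (\<Union>S) (Upper (Omega X) S)"
  by (auto simp: least_def Upper_def)

text \<open>Serves the infimum axiom of \<open>complete_lattice\<close>. The interior is taken
  because an infinite intersection of open sets may fail to be open; for empty \<open>S\<close> the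
  formula yields the whole space.\<close>

lemma greatest_Omega:
  assumes S: "S \<subseteq> carrier (Omega X)"
  shows "greatest (Omega X) (topo X interior_of (topspace (topo X) \<inter> \<Inter>S)) (Lower (Omega X) S)"
proof -
  let ?I = "topo X interior_of (topspace (topo X) \<inter> \<Inter>S)"
  have "?I \<subseteq> \<Inter>S" using interior_of_subset[of "topo X" "topspace (topo X) \<inter> \<Inter>S"] by blast
  moreover have "U \<subseteq> ?I" if "openin (topo X) U" "U \<subseteq> \<Inter>S" for U
    using that by (intro interior_of_maximal Int_greatest openin_subset)
  ultimately show ?thesis using S unfolding greatest_def Lower_def
    by (simp add: Ball_def subset_iff[of S])  (meson Inter_greatest Inf_lower order_trans)
qed

lemma complete_lattice_Omega: "complete_lattice (Omega X)"
proof -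
  interpret partial_order "Omega X" by (rule partial_order_Omega)
  show ?thesis by unfold_locales (blast intro: least_Omega greatest_Omega)+
qed

lemma sup_Omega: "S \<subseteq> carrier (Omega X) \<Longrightarrow> \<Squnion>\<^bsub>Omega X\<^esub>S = \<Union>S"
proof -
  interpret complete_lattice "Omega X" by (rule complete_lattice_Omega)
  assume "S \<subseteq> carrier (Omega X)"
  then show ?thesis using sup_lub least_Omega least_unique by blast
qed

lemma meet_Omega:
  assumes "openin (topo X) U" "openin (topo X) V"
  shows "U \<sqinter>\<^bsub>Omega X\<^esub> V = U \<inter> V"
proof -
  interpret complete_lattice "Omega X" by (rule complete_lattice_Omega)
  have "U \<sqinter>\<^bsub>Omega X\<^esub> V \<subseteq> U" "U \<sqinter>\<^bsub>Omega X\<^esub> V \<subseteq> V" "U \<inter> V \<subseteq> U \<sqinter>\<^bsub>Omega X\<^esub> V"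
    using meet_left[of U V] meet_right[of U V] meet_le[of "U \<inter> V" U V] assms
    by (auto simp: openin_Int)
  then show ?thesis by blast
qed

lemma top_Omega: "\<top>\<^bsub>Omega X\<^esub> = topspace (topo X)"
proof -
  interpret complete_lattice "Omega X" by (rule complete_lattice_Omega)
  show ?thesis
    using top_closed top_higher[of "topspace (topo X)"] openin_subset[of "topo X"] by auto
qed

lemma bottom_Omega: "\<bottom>\<^bsub>Omega X\<^esub> = {}"
proof -
  interpret complete_lattice "Omega X" by (rule complete_lattice_Omega)
  show ?thesis using bottom_lower[of "{}"] by auto
qed

lemma is_frame_Omega: "is_frame (Omega X)"
proof -
  have "a \<sqinter>\<^bsub>Omega X\<^esub> \<Squnion>\<^bsub>Omega X\<^esub>S = \<Squnion>\<^bsub>Omega X\<^esub>((\<lambda>s. a \<sqinter>\<^bsub>Omega X\<^esub> s) ` S)"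
    if a: "a \<in> carrier (Omega X)" and S: "S \<subseteq> carrier (Omega X)" for a S
  proof -
    have "(\<lambda>s. a \<sqinter>\<^bsub>Omega X\<^esub> s) ` S = (\<lambda>s. a \<inter> s) ` S"
      using a S by (intro image_cong) (auto simp: meet_Omega)
    moreover have "(\<lambda>s. a \<inter> s) ` S \<subseteq> carrier (Omega X)" using a S by auto
    moreover have "openin (topo X) (\<Union>S)" using S by auto
    ultimately show ?thesis using a S by (simp add: sup_Omega meet_Omega)
  qed
  then show ?thesis by (simp add: is_frame_def complete_lattice_Omega)
qed

text \<open>The axioms hold pointwise for \<open>box_rel\<close> and \<open>dia_rel\<close>, and
  they survive the passage to interiors because interiors are monotone and commute with binary
  intersections. \<open>rel_space\<close> keeps successors inside the space, which gives the axiom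
  for top.\<close>

lemma modal_frame_Omega:
  assumes X: "rel_space X"
  shows "modal_frame (Omega X)"
proof -
  interpret complete_lattice "Omega X" by (rule complete_lattice_Omega)
  have "box_rel X (topspace (topo X)) = topspace (topo X)"
    using X by (auto simp: box_rel_def rel_space_def)
  then have 1: "topspace (topo X) \<subseteq> topo X interior_of box_rel X (topspace (topo X))"
    by simp
  have 2: "topo X interior_of box_rel X U \<inter> topo X interior_of box_rel X V \<subseteq>
      topo X interior_of box_rel X (U \<inter> V)" for U V
    unfolding interior_of_Int[symmetric] by (rule interior_of_mono) (auto simp: box_rel_def)
  have 3: "topo X interior_of box_rel X U \<inter> topo X interior_of dia_rel X V \<subseteq>
      topo X interior_of dia_rel X (U \<inter> V)" for U V
    unfolding interior_of_Int[symmetric]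
    by (rule interior_of_mono) (auto simp: box_rel_def dia_rel_def)
  have 4: "dia_rel X {} = {}" by (simp add: dia_rel_def)
  have "box_rel X U \<subseteq> box_rel X V" "dia_rel X U \<subseteq> dia_rel X V" if "U \<subseteq> V" for U V
    using that by (auto simp: box_rel_def dia_rel_def)
  then have "Mono\<^bsub>Omega X\<^esub> (nec (Omega X))" "Mono\<^bsub>Omega X\<^esub> (pos (Omega X))"
    using weak_partial_order_axioms by (simp_all add: isotone_def interior_of_mono)
  then show ?thesis
    unfolding modal_frame_def
    by (simp add: is_frame_Omega top_Omega bottom_Omega meet_Omega 1 2 3 4)
qed

lemma nec_Omega_usc: "usc X \<Longrightarrow> openin (topo X) U \<Longrightarrow> nec (Omega X) U = box_rel X U"
  and pos_Omega_lsc: "lsc X \<Longrightarrow> openin (topo X) U \<Longrightarrow> pos (Omega X) U = dia_rel X U"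
  by (simp_all add: usc_def lsc_def interior_of_openin)

text \<open>Continuity removes the interiors; what remains are the usual modal correspondences with
  reflexivity, transitivity and symmetry.\<close>

lemma equivalence_frame_Omega:
  assumes "rel_space X" "lsc X" "usc X" and R: "equiv (topspace (topo X)) (acc X)"
  shows "equivalence_frame (Omega X)"
proof -
  have op: "openin (topo X) (box_rel X U)" "openin (topo X) (dia_rel X U)" if "openin (topo X) U" for U
    using that assms by (auto simp: usc_def lsc_def)
  have refl: "(x, x) \<in> acc X" if "x \<in> topspace (topo X)" for x
    using R that by (auto simp: equiv_def refl_on_def)
  have sym: "(y, x) \<in> acc X" if "(x, y) \<in> acc X" for x y
    using R that by (auto simp: equiv_def sym_def)
  have trans: "(x, z) \<in> acc X" if "(x, y) \<in> acc X" "(y, z) \<in> acc X" for x y z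
    using R that by (auto simp: equiv_def intro: transD)
  have sp: "y \<in> topspace (topo X)" if "(x, y) \<in> acc X" for x y
    using assms(1) that by (auto simp: rel_space_def)
  have "box_rel X U \<subseteq> U \<and> U \<subseteq> dia_rel X U \<and> box_rel X U \<subseteq> box_rel X (box_rel X U) \<and>
      dia_rel X (dia_rel X U) \<subseteq> dia_rel X U \<and> dia_rel X (box_rel X U) \<subseteq> U \<and>
      U \<subseteq> box_rel X (dia_rel X U)" if U: "openin (topo X) U" for U
  proof (intro conjI subsetI)
    note sub = subsetD[OF openin_subset[OF U]]
    show "x \<in> U" if "x \<in> box_rel X U" for x using that refl by (auto simp: box_rel_def)
    show "x \<in> dia_rel X U" if "x \<in> U" for x using that refl sub by (auto simp: dia_rel_def)
    show "x \<in> box_rel X (box_rel X U)" if "x \<in> box_rel X U" for x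
      using that trans sp unfolding box_rel_def by blast
    show "x \<in> dia_rel X U" if "x \<in> dia_rel X (dia_rel X U)" for x
      using that trans unfolding dia_rel_def by blast
    show "x \<in> U" if "x \<in> dia_rel X (box_rel X U)" for x
      using that sym unfolding box_rel_def dia_rel_def by blast
    show "x \<in> box_rel X (dia_rel X U)" if "x \<in> U" for x
      using that sym sub sp unfolding box_rel_def dia_rel_def by blast
  qed
  then show ?thesis
    unfolding equivalence_frame_def
    using assms(1) by (simp add: modal_frame_Omega op interior_of_openin)
qed

section \<open>A uniform description of the seven cases\<close>

definition triples :: "space_cat \<Rightarrow> bool" where
  "triples D \<longleftrightarrow> D \<notin> {RelSp, RelSp_l}"

text \<open>Marks the cases in which lower semicontinuity of spaces, diamond-strictness of morphisms
  and \<open>largest_avoid\<close> for points occur together; \<open>upper\<close> does the same for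
  upper semicontinuity, box-strictness and \<open>least_filter\<close>.\<close>

definition lower :: "space_cat \<Rightarrow> bool" where
  "lower D \<longleftrightarrow> D \<in> {RelSp_l, RelSpq_l, RelSpq_c, EqSpq}"

definition upper :: "space_cat \<Rightarrow> bool" where
  "upper D \<longleftrightarrow> D \<in> {RelSpq_u, RelSpq_c, EqSpq}"

lemma upper_triples: "upper D \<Longrightarrow> triples D"
  by (auto simp: upper_def triples_def)

definition mkpt :: "space_cat \<Rightarrow> ('a \<Rightarrow> bool) \<Rightarrow> 'a \<Rightarrow> 'a set \<Rightarrow> 'a pt" where
  "mkpt D p a F = (if triples D then Pt3 p a F else Pt2 p a)"

text \<open>For a pair $(p,a)$ the filter of a triple is replaced by \<^const>\<open>char_filter\<close>; then both
  clauses of \<^const>\<open>pt_rel\<close> read alike.\<close>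

definition filt :: "'a mframe \<Rightarrow> 'a pt \<Rightarrow> 'a set" where
  "filt A x = (case x of Pt2 p a \<Rightarrow> char_filter A p | Pt3 p a F \<Rightarrow> F)"

lemma ch_mkpt [simp]: "ch (mkpt D p a F) = p"
  and av_mkpt [simp]: "av (mkpt D p a F) = a"
  and filt_mkpt: "filt A (mkpt D p a F) = (if triples D then F else char_filter A p)"
  by (simp_all add: mkpt_def filt_def)

text \<open>The cases are enumerated in this group of characterizations and in
  \<open>mem_prepoints_iff\<close>, so that most later arguments see only the switches.\<close>

lemma dual_pairs_frame_obj:
  "(C, D) \<in> dual_pairs \<Longrightarrow>
    fr_obj C A \<longleftrightarrow> modal_frame A \<and> (D = EqSpq \<longrightarrow> equivalence_frame A)"
  by (auto simp: dual_pairs_def fr_obj_def equivalence_frame_def)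

lemma dual_pairs_frame_hom:
  "(C, D) \<in> dual_pairs \<Longrightarrow>
    f \<in> fr_hom C A B \<longleftrightarrow>
      f \<in> mf_morphisms A B \<and> (lower D \<longrightarrow> dia_strict A B f) \<and> (upper D \<longrightarrow> box_strict A B f)"
  unfolding dual_pairs_def fr_hom_def lower_def upper_def by (elim insertE emptyE; simp; blast?)

lemma sp_obj_iff:
  "sp_obj D X \<longleftrightarrow> rel_space X \<and> (lower D \<longrightarrow> lsc X) \<and> (upper D \<longrightarrow> usc X) \<and>
    (D = EqSpq \<longrightarrow> equiv (topspace (topo X)) (acc X))"
  by (cases D) (auto simp: sp_obj_def lower_def upper_def)

lemma sp_hom_iff:
  "h \<in> sp_hom D X Y \<longleftrightarrow> h \<in> p_morphisms X Y \<and> (triples D \<longrightarrow> h \<in> pq_morphisms X Y)"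
  by (auto simp: sp_hom_def triples_def pq_morphisms_def)

lemma fr_obj_Omega:
  assumes "(C, D) \<in> dual_pairs" "sp_obj D X"
  shows "fr_obj C (Omega X)"
  using assms equivalence_frame_Omega[of X]
  by (auto simp: dual_pairs_frame_obj sp_obj_iff modal_frame_Omega lower_def upper_def)

text \<open>The equation for \<open>x\<close> expresses that its shape, pair or triple, fits
  \<open>D\<close>. For a pair the filter conditions hold automatically, since \<open>filt\<close>
  is then \<open>char_filter\<close>.\<close>

lemma mem_prepoints_iff:
  assumes A: "modal_frame A"
  shows "x \<in> prepoints D A \<longleftrightarrow>
    x = mkpt D (ch x) (av x) (filt A x) \<and> ch x \<in> characters A \<and> av x \<in> carrier A \<and>
    is_filter A (filt A x) \<and> \<not> ch x (pos A (av x)) \<and> char_filter A (ch x) \<subseteq> filt A x \<and>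
    (lower D \<longrightarrow> largest_avoid A x) \<and> (upper D \<longrightarrow> filt A x \<subseteq> char_filter A (ch x))"
proof (cases x)
  case (Pt2 p a)
  then show ?thesis
    using is_filter_char_filter[OF A, of p]
    by (cases D) (auto simp: prepoints_def pre_pairs_def pre_triples_def mkpt_def triples_def
        filt_def lower_def upper_def)
next
  case (Pt3 p a F)
  then show ?thesis
    by (cases D) (auto simp: prepoints_def pre_pairs_def pre_triples_def mkpt_def triples_def
        filt_def lower_def upper_def least_filter_def)
qed

lemma pt_rel_iff:
  assumes "modal_frame A" "x \<in> prepoints D A" "y \<in> prepoints D A"
  shows "pt_rel A x y \<longleftrightarrow> \<not> ch y (av x) \<and> (\<forall>c\<in>filt A x. ch y c)"
proof -
  have "x = mkpt D (ch x) (av x) (filt A x)" "y = mkpt D (ch y) (av y) (filt A y)"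
    using assms by (simp_all add: mem_prepoints_iff)
  then show ?thesis
    by (cases x; cases y) (auto simp: mkpt_def filt_def char_filter_def split: if_splits)
qed

lemma mem_prepointsD:
  assumes "modal_frame A" "x \<in> prepoints D A"
  shows "mkpt D (ch x) (av x) (filt A x) = x" and "ch x \<in> characters A" and "av x \<in> carrier A"
    and "is_filter A (filt A x)" and "filt A x \<subseteq> carrier A"
    and "\<not> ch x (pos A (av x))"
    and "\<And>c. c \<in> carrier A \<Longrightarrow> ch x (nec A c) \<Longrightarrow> c \<in> filt A x"
    and "\<And>c. lower D \<Longrightarrow> c \<in> carrier A \<Longrightarrow> \<not> ch x (pos A c) \<Longrightarrow> c \<sqsubseteq>\<^bsub>A\<^esub> av x"
    and "\<And>c. \<not> triples D \<or> upper D \<Longrightarrow> c \<in> filt A x \<Longrightarrow> ch x (nec A c)"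
proof -
  note x = assms(2)[unfolded mem_prepoints_iff[OF assms(1)]]
  show "mkpt D (ch x) (av x) (filt A x) = x" "ch x \<in> characters A" "av x \<in> carrier A"
    "is_filter A (filt A x)" "\<not> ch x (pos A (av x))" using x by simp_all
  show "filt A x \<subseteq> carrier A" using x by (simp add: is_filter_def)
  show "c \<in> filt A x" if "c \<in> carrier A" "ch x (nec A c)" for c
    using x that by (auto simp: char_filter_def)
  show "c \<sqsubseteq>\<^bsub>A\<^esub> av x" if "lower D" "c \<in> carrier A" "\<not> ch x (pos A c)" for c
    using x that by (simp add: largest_avoid_def)
  show "ch x (nec A c)" if "\<not> triples D \<or> upper D" "c \<in> filt A x" for c
  proof -
    have "\<not> triples D \<longrightarrow> filt A x = char_filter A (ch x)"
      using x filt_mkpt[of A D "ch x" "av x" "filt A x"] by metis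
    then show ?thesis using x that by (auto simp: char_filter_def)
  qed
qed

text \<open>Coinduction principle for \<open>points\<close> in the uniform notation. Box witnesses
  are demanded for \<open>triples D\<close> only, as a \<open>Pt3\<close> among the prepoints forces
  that case.\<close>

lemma points_subsetI:
  assumes A: "modal_frame A" and S: "S \<subseteq> prepoints D A"
    and D: "\<And>x c. x \<in> S \<Longrightarrow> c \<in> carrier A \<Longrightarrow> \<not> c \<sqsubseteq>\<^bsub>A\<^esub> av x \<Longrightarrow>
      \<exists>y\<in>S. \<not> ch y (av x) \<and> (\<forall>d\<in>filt A x. ch y d) \<and> ch y c"
    and B: "\<And>x c. triples D \<Longrightarrow> x \<in> S \<Longrightarrow> c \<in> carrier A \<Longrightarrow> c \<notin> filt A x \<Longrightarrow>
      \<exists>y\<in>S. \<not> ch y (av x) \<and> (\<forall>d\<in>filt A x. ch y d) \<and> \<not> ch y c"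
  shows "S \<subseteq> points D A"
proof (rule points_largest(4)[OF S])
  note rel = pt_rel_iff[OF A subsetD[OF S] subsetD[OF S]]
  show "dia_witnessed A S"
    unfolding dia_witnessed_def using D by (simp cong: bex_cong add: rel conj_assoc)
  show "box_witnessed A S"
    unfolding box_witnessed_def
  proof (intro allI impI ballI)
    fix p a F c assume x: "Pt3 p a F \<in> S" and c: "c \<in> carrier A" "c \<notin> F"
    have "triples D"
      using mem_prepointsD(1)[OF A subsetD[OF S x]] by (auto simp: mkpt_def split: if_splits)
    then have "\<exists>y\<in>S. \<not> ch y a \<and> (\<forall>d\<in>F. ch y d) \<and> \<not> ch y c"
      using B[OF _ x] c by (simp add: filt_def)
    then show "\<exists>y\<in>S. pt_rel A (Pt3 p a F) y \<and> \<not> ch y c"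
      using rel[OF x] by (auto simp: filt_def)
  qed
qed

section \<open>The space of points\<close>

lemma openin_Fsp_iff: "modal_frame A \<Longrightarrow> openin (topo (Fsp D A)) U \<longleftrightarrow> (\<exists>c\<in>carrier A. U = phi D A c)"
  by (auto simp: openin_Fsp)

lemma mem_phi_iff: "x \<in> phi D A c \<longleftrightarrow> x \<in> points D A \<and> ch x c"
  by (simp add: phi_def)

lemma topspace_Fsp:
  assumes A: "modal_frame A"
  shows "topspace (topo (Fsp D A)) = points D A"
proof -
  interpret complete_lattice A by (rule modal_frame_complete_lattice[OF A])
  have "phi D A \<top>\<^bsub>A\<^esub> = points D A"
    using ch_character by (auto simp: phi_def character_iff)
  then have "openin (topo (Fsp D A)) (points D A)"
    unfolding openin_Fsp_iff[OF A] using top_closed by metis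
  moreover have "U \<subseteq> points D A" if "openin (topo (Fsp D A)) U" for U
    using that by (auto simp: openin_Fsp_iff[OF A] phi_def)
  ultimately show ?thesis by (meson openin_subset openin_topspace subset_antisym)
qed

lemma point_in_prepoints: "x \<in> points D A \<Longrightarrow> x \<in> prepoints D A"
  using points_largest(1) by blast

lemmas pointD = mem_prepointsD[OF _ point_in_prepoints]

lemma acc_Fsp_iff:
  "modal_frame A \<Longrightarrow> (x, y) \<in> acc (Fsp D A) \<longleftrightarrow>
    x \<in> points D A \<and> y \<in> points D A \<and> \<not> ch y (av x) \<and> (\<forall>c\<in>filt A x. ch y c)"
  using pt_rel_iff[OF _ point_in_prepoints point_in_prepoints] by (auto simp: Fsp_def)

lemma rel_space_Fsp: "modal_frame A \<Longrightarrow> rel_space (Fsp D A)"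
  by (auto simp: rel_space_def topspace_Fsp acc_Fsp_iff)

text \<open>One direction is \<open>dia_witnessed\<close> contraposed. For the other, a related
  point rejects \<open>av x\<close> and therefore, by monotonicity of its character, everything
  below.\<close>

lemma acc_Fsp_disjoint_phi_iff:
  assumes A: "modal_frame A" and x: "x \<in> points D A" and c: "c \<in> carrier A"
  shows "acc (Fsp D A) `` {x} \<inter> phi D A c = {} \<longleftrightarrow> c \<sqsubseteq>\<^bsub>A\<^esub> av x"
proof
  assume "c \<sqsubseteq>\<^bsub>A\<^esub> av x"
  then have "ch y (av x)" if "y \<in> points D A" "ch y c" for y
    using character_mono[OF A ch_character] that c pointD(3)[OF A x] by blast
  then show "acc (Fsp D A) `` {x} \<inter> phi D A c = {}"
    by (auto simp: acc_Fsp_iff[OF A] mem_phi_iff)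
next
  assume "acc (Fsp D A) `` {x} \<inter> phi D A c = {}"
  moreover have "\<not> c \<sqsubseteq>\<^bsub>A\<^esub> av x \<Longrightarrow> \<exists>y\<in>points D A. pt_rel A x y \<and> ch y c"
    using points_largest(2)[of A D] x c by (auto simp: dia_witnessed_def)
  ultimately show "c \<sqsubseteq>\<^bsub>A\<^esub> av x" using x by (auto simp: Fsp_def phi_def)
qed

lemma acc_Fsp_subset_phi:
  "modal_frame A \<Longrightarrow> c \<in> filt A x \<Longrightarrow> acc (Fsp D A) `` {x} \<subseteq> phi D A c"
  by (auto simp: acc_Fsp_iff mem_phi_iff)

text \<open>The new direction is \<open>box_witnessed\<close> contraposed, which speaks about
  triples only; the converse is built into the relation.\<close>

lemma acc_Fsp_subset_phi_iff:
  assumes A: "modal_frame A" and D: "triples D" and x: "x \<in> points D A" and c: "c \<in> carrier A"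
  shows "acc (Fsp D A) `` {x} \<subseteq> phi D A c \<longleftrightarrow> c \<in> filt A x"
proof
  assume *: "acc (Fsp D A) `` {x} \<subseteq> phi D A c"
  have x_eq: "x = Pt3 (ch x) (av x) (filt A x)"
    using pointD(1)[OF A x] D by (simp add: mkpt_def)
  then have "c \<notin> filt A x \<Longrightarrow> \<exists>y\<in>points D A. pt_rel A x y \<and> \<not> ch y c"
    using points_largest(3)[of A D] x c unfolding box_witnessed_def by metis
  with * show "c \<in> filt A x" using x by (auto simp: Fsp_def phi_def)
qed (rule acc_Fsp_subset_phi[OF A])

text \<open>The character rejects \<open>pos A (av x)\<close>, so if it accepts
  \<open>pos A c\<close>, then \<open>c\<close> is not below \<open>av x\<close>, and a successor in
  \<open>phi D A c\<close> exists.\<close>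

lemma dia_rel_phi_superset:
  assumes A: "modal_frame A" and c: "c \<in> carrier A"
  shows "phi D A (pos A c) \<subseteq> dia_rel (Fsp D A) (phi D A c)"
proof
  fix x assume "x \<in> phi D A (pos A c)"
  then have x: "x \<in> points D A" and p: "ch x (pos A c)" by (auto simp: phi_def)
  have "\<not> c \<sqsubseteq>\<^bsub>A\<^esub> av x"
    using character_mono[OF A ch_character[OF x], of "pos A c" "pos A (av x)"] p pos_mono[OF A]
      pos_closed[OF A] c pointD(3,6)[OF A x] by blast
  then show "x \<in> dia_rel (Fsp D A) (phi D A c)"
    using acc_Fsp_disjoint_phi_iff[OF A x c] x by (simp add: dia_rel_def topspace_Fsp[OF A])
qed

text \<open>The extra inclusion comes from maximality of \<open>av x\<close>: an element whose
  diamond is rejected must lie below it. This makes the space of points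
  lower-semicontinuous.\<close>

lemma dia_rel_phi:
  assumes A: "modal_frame A" and D: "lower D" and c: "c \<in> carrier A"
  shows "dia_rel (Fsp D A) (phi D A c) = phi D A (pos A c)"
proof
  show "dia_rel (Fsp D A) (phi D A c) \<subseteq> phi D A (pos A c)"
  proof
    fix x assume "x \<in> dia_rel (Fsp D A) (phi D A c)"
    then have x: "x \<in> points D A" and "\<not> c \<sqsubseteq>\<^bsub>A\<^esub> av x"
      using acc_Fsp_disjoint_phi_iff[OF A _ c] by (auto simp only: dia_rel_def topspace_Fsp[OF A])
    then show "x \<in> phi D A (pos A c)" using pointD(8)[OF A x D c] by (auto simp: mem_phi_iff)
  qed
qed (rule dia_rel_phi_superset[OF A c])

lemma box_rel_phi_superset:
  assumes A: "modal_frame A" and c: "c \<in> carrier A"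
  shows "phi D A (nec A c) \<subseteq> box_rel (Fsp D A) (phi D A c)"
proof
  fix x assume "x \<in> phi D A (nec A c)"
  then have x: "x \<in> points D A" and "c \<in> filt A x"
    using pointD(7)[OF A _ c] by (auto simp: mem_phi_iff)
  then show "x \<in> box_rel (Fsp D A) (phi D A c)"
    using acc_Fsp_subset_phi[OF A] by (simp add: box_rel_def topspace_Fsp[OF A])
qed

text \<open>Here the filter is \<open>char_filter\<close>, and \<open>upper_triples\<close>
  guarantees that box witnesses are available. Upper semicontinuity follows.\<close>

lemma box_rel_phi:
  assumes A: "modal_frame A" and D: "upper D" and c: "c \<in> carrier A"
  shows "box_rel (Fsp D A) (phi D A c) = phi D A (nec A c)"
proof
  show "box_rel (Fsp D A) (phi D A c) \<subseteq> phi D A (nec A c)"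
  proof
    fix x assume "x \<in> box_rel (Fsp D A) (phi D A c)"
    then have x: "x \<in> points D A" and "c \<in> filt A x"
      using acc_Fsp_subset_phi_iff[OF A upper_triples[OF D] _ c]
      by (auto simp only: box_rel_def topspace_Fsp[OF A])
    then show "x \<in> phi D A (nec A c)" using pointD(9)[OF A x] D by (auto simp: mem_phi_iff)
  qed
qed (rule box_rel_phi_superset[OF A c])

text \<open>With all four conditions on prepoints, \<open>av x\<close> and \<open>filt A x\<close>
  are determined by the character through \<open>pos A\<close> and \<open>nec A\<close> (facts
  \<open>le_av\<close> and \<open>filt\<close>). Each property of the relation then reduces to the
  matching pair of frame axioms.\<close>

lemma equiv_Fsp:
  assumes "equivalence_frame A"
  shows "equiv (points EqSpq A) (acc (Fsp EqSpq A))"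
proof -
  have A: "modal_frame A" using assms by (simp add: equivalence_frame_def)
  note [simp] = nec_closed[OF A] pos_closed[OF A]
  note eq = assms[unfolded equivalence_frame_def, THEN conjunct2, rule_format]
  note mono = character_mono[OF A ch_character]
  have lu: "lower EqSpq" "upper EqSpq" by (simp_all add: lower_def upper_def)
  note av = pointD(3)[OF A]
  have le_av: "c \<sqsubseteq>\<^bsub>A\<^esub> av x \<longleftrightarrow> \<not> ch x (pos A c)" if "x \<in> points EqSpq A" "c \<in> carrier A" for x c
    using that pointD(6,8)[OF A that(1)] lu mono[OF that(1), of "pos A c" "pos A (av x)"]
      pos_mono[OF A] av[OF that(1)] by auto
  have filt: "c \<in> filt A x \<longleftrightarrow> c \<in> carrier A \<and> ch x (nec A c)" if "x \<in> points EqSpq A" for x c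
    using pointD(5,7,9)[OF A that] lu by auto
  have rel: "(x, y) \<in> acc (Fsp EqSpq A) \<longleftrightarrow> x \<in> points EqSpq A \<and> y \<in> points EqSpq A \<and>
      \<not> ch y (av x) \<and> (\<forall>c\<in>carrier A. ch x (nec A c) \<longrightarrow> ch y c)" for x y
    using acc_Fsp_iff[OF A] filt by blast
  have refl: "(x, x) \<in> acc (Fsp EqSpq A)" if x: "x \<in> points EqSpq A" for x
  proof -
    have "\<not> ch x (av x)"
      using mono[OF x, of "av x" "pos A (av x)"] eq[of "av x"] av[OF x] pointD(6)[OF A x] by auto
    moreover have "ch x c" if "c \<in> carrier A" "ch x (nec A c)" for c
      using mono[OF x, of "nec A c" c] eq[of c] that by simp
    ultimately show ?thesis using x by (simp add: rel)
  qed
  have sym: "(y, x) \<in> acc (Fsp EqSpq A)" if xy: "(x, y) \<in> acc (Fsp EqSpq A)" for x y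
  proof -
    have x: "x \<in> points EqSpq A" and y: "y \<in> points EqSpq A" using xy by (simp_all add: rel)
    let ?b = "av y"
    have b: "?b \<in> carrier A" by (rule av[OF y])
    \<comment> \<open>Half of symmetry, from \<open>b \<le> nec A (pos A b)\<close>: accepting
      \<open>b = av y\<close> at \<open>x\<close> would make \<open>y\<close> accept
      \<open>pos A b\<close>.\<close>
    have "\<not> ch x ?b"
    proof
      assume "ch x ?b"
      then have "ch x (nec A (pos A ?b))"
        using mono[OF x, of ?b "nec A (pos A ?b)"] eq[OF b] b by simp
      then have "ch y (pos A ?b)" using xy b by (simp add: rel)
      then show False using pointD(6)[OF A y] by simp
    qed
    moreover have "ch x c" if c: "c \<in> carrier A" "ch y (nec A c)" for c
    proof -
      \<comment> \<open>The other half, from \<open>pos A (nec A c) \<le> c\<close>: as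
        \<open>y\<close> accepts \<open>nec A c\<close> and rejects \<open>av x\<close>, the diamond
        of \<open>nec A c\<close> is accepted at \<open>x\<close>.\<close>
      have "\<not> nec A c \<sqsubseteq>\<^bsub>A\<^esub> av x"
        using mono[OF y, of "nec A c" "av x"] c av[OF x] xy by (auto simp: rel)
      then have "ch x (pos A (nec A c))" using le_av[OF x] c by simp
      then show ?thesis using mono[OF x, of "pos A (nec A c)" c] eq[of c] c by simp
    qed
    ultimately show ?thesis using x y by (simp add: rel)
  qed
  have trans: "(x, z) \<in> acc (Fsp EqSpq A)"
    if xy: "(x, y) \<in> acc (Fsp EqSpq A)" and yz: "(y, z) \<in> acc (Fsp EqSpq A)" for x y z
  proof -
    have x: "x \<in> points EqSpq A" and y: "y \<in> points EqSpq A" and z: "z \<in> points EqSpq A"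
      using xy yz by (simp_all add: rel)
    let ?a = "av x"
    have a: "?a \<in> carrier A" by (rule av[OF x])
    \<comment> \<open>Since \<open>av x\<close> is the largest element with rejected diamond, the
      axiom for iterated diamonds puts \<open>pos A (av x)\<close> below \<open>av x\<close>. So
      \<open>y\<close> rejects it, which means that \<open>av x\<close> is below \<open>av y\<close>
      and hence rejected by \<open>z\<close>.\<close>
    have "\<not> ch x (pos A (pos A ?a))"
      using mono[OF x, of "pos A (pos A ?a)" "pos A ?a"] eq[OF a] a pointD(6)[OF A x] by auto
    then have "pos A ?a \<sqsubseteq>\<^bsub>A\<^esub> ?a" using le_av[OF x] a by simp
    then have "\<not> ch y (pos A ?a)" using mono[OF y, of "pos A ?a" ?a] a xy by (auto simp: rel)
    then have "?a \<sqsubseteq>\<^bsub>A\<^esub> av y" using le_av[OF y a] by simp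
    then have "\<not> ch z ?a" using mono[OF z a av[OF y]] yz by (auto simp: rel)
    moreover have "ch z c" if c: "c \<in> carrier A" "ch x (nec A c)" for c
    proof -
      have "ch x (nec A (nec A c))" using mono[OF x, of "nec A c" "nec A (nec A c)"] eq[of c] c by simp
      then show ?thesis using xy yz c by (simp add: rel)
    qed
    ultimately show ?thesis using x z by (simp add: rel)
  qed
  show ?thesis
  proof (intro equivI refl_onI symI transI refl)
    show "acc (Fsp EqSpq A) \<subseteq> points EqSpq A \<times> points EqSpq A" using rel by auto
  qed (blast intro: sym trans)+
qed

lemma sp_obj_Fsp:
  assumes CD: "(C, D) \<in> dual_pairs" and C: "fr_obj C A"
  shows "sp_obj D (Fsp D A)"
proof -
  have A: "modal_frame A" and E: "D = EqSpq \<Longrightarrow> equivalence_frame A"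
    using C by (simp_all add: dual_pairs_frame_obj[OF CD])
  have "lsc (Fsp D A)" if "lower D"
    using dia_rel_phi[OF A that] pos_closed[OF A] by (auto simp: lsc_def openin_Fsp_iff[OF A])
  moreover have "usc (Fsp D A)" if "upper D"
    using box_rel_phi[OF A that] nec_closed[OF A] by (auto simp: usc_def openin_Fsp_iff[OF A])
  ultimately show ?thesis
    using equiv_Fsp[of A] E rel_space_Fsp[OF A] by (simp add: sp_obj_iff topspace_Fsp[OF A])
qed

section \<open>The two functors on morphisms\<close>

lemma Fsp_mor_point:
  assumes "modal_frame B" "x \<in> points D B"
  shows "Fsp_mor D A B f x = mkpt D (\<lambda>c\<in>carrier A. ch x (f c))
    (\<Squnion>\<^bsub>A\<^esub>{c \<in> carrier A. f c \<sqsubseteq>\<^bsub>B\<^esub> av x}) {c \<in> carrier A. f c \<in> filt B x}"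
proof (cases "triples D")
  case True
  then have "x = Pt3 (ch x) (av x) (filt B x)" using pointD(1)[OF assms] by (simp add: mkpt_def)
  then show ?thesis using assms(2) True
    by (cases x) (simp_all add: Fsp_mor_def mkpt_def Let_def)
next
  case False
  then have "x = Pt2 (ch x) (av x)" using pointD(1)[OF assms] by (simp add: mkpt_def)
  then show ?thesis using assms(2) False
    by (cases x) (simp_all add: Fsp_mor_def mkpt_def Let_def)
qed

context
  fixes A :: "'a mframe" and B :: "'b mframe" and f :: "'a \<Rightarrow> 'b"
  assumes A: "modal_frame A" and B: "modal_frame B" and f: "f \<in> mf_morphisms A B"
begin

lemma mf_frame_morphism: "f \<in> frame_morphisms A B"
  using f by (simp add: mf_morphisms_def)

lemma mf_closed: "c \<in> carrier A \<Longrightarrow> f c \<in> carrier B"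
  by (rule frame_morphism_closed[OF mf_frame_morphism])

lemma mf_nec_le: "c \<in> carrier A \<Longrightarrow> f (nec A c) \<sqsubseteq>\<^bsub>B\<^esub> nec B (f c)"
  and mf_pos_le: "c \<in> carrier A \<Longrightarrow> f (pos A c) \<sqsubseteq>\<^bsub>B\<^esub> pos B (f c)"
  using f by (auto simp: mf_morphisms_def)

lemma ch_Fsp_mor: "x \<in> points D B \<Longrightarrow> ch (Fsp_mor D A B f x) = (\<lambda>c\<in>carrier A. ch x (f c))"
  by (simp add: Fsp_mor_point[OF B])

lemma av_Fsp_mor_closed: "x \<in> points D B \<Longrightarrow> av (Fsp_mor D A B f x) \<in> carrier A"
proof -
  interpret complete_lattice A by (rule modal_frame_complete_lattice[OF A])
  show "x \<in> points D B \<Longrightarrow> av (Fsp_mor D A B f x) \<in> carrier A"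
    by (simp add: Fsp_mor_point[OF B] sup_closed)
qed

text \<open>The adjunction \<open>le_sup_iff\<close> at the level of points: the second test at the
  image is the second test at \<open>x\<close> on \<open>f c\<close>.\<close>

lemma le_av_Fsp_mor_iff:
  "x \<in> points D B \<Longrightarrow> c \<in> carrier A \<Longrightarrow> c \<sqsubseteq>\<^bsub>A\<^esub> av (Fsp_mor D A B f x) \<longleftrightarrow> f c \<sqsubseteq>\<^bsub>B\<^esub> av x"
  using le_sup_iff[OF modal_frame_is_frame[OF A] modal_frame_is_frame[OF B] mf_frame_morphism
      pointD(3)[OF B]]
  by (simp add: Fsp_mor_point[OF B])

lemma av_Fsp_mor_le:
  assumes "x \<in> points D B"
  shows "f (av (Fsp_mor D A B f x)) \<sqsubseteq>\<^bsub>B\<^esub> av x"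
proof -
  interpret complete_lattice A by (rule modal_frame_complete_lattice[OF A])
  show ?thesis 
    using le_av_Fsp_mor_iff[OF assms av_Fsp_mor_closed[OF assms]] le_refl[OF av_Fsp_mor_closed[OF assms]]
    by blast
qed

lemma filt_Fsp_mor_iff:
  "triples D \<Longrightarrow> x \<in> points D B \<Longrightarrow> c \<in> filt A (Fsp_mor D A B f x) \<longleftrightarrow> c \<in> carrier A \<and> f c \<in> filt B x"
  by (simp add: Fsp_mor_point[OF B] filt_mkpt)

text \<open>For triples this is half of \<open>filt_Fsp_mor_iff\<close>. For pairs the image carries
  the \<open>char_filter\<close> of the composed character, and
  \<open>f (nec A c) \<le> nec B (f c)\<close> yields just this inclusion, which is enough to
  preserve the relation.\<close>

lemma filt_Fsp_morD:
  assumes x: "x \<in> points D B" and c: "c \<in> filt A (Fsp_mor D A B f x)"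
  shows "c \<in> carrier A" "f c \<in> filt B x"
proof -
  have "c \<in> carrier A \<and> f c \<in> filt B x"
  proof (cases "triples D")
    case False
    then have cA: "c \<in> carrier A" and "ch x (f (nec A c))"
      using c nec_closed[OF A] by (auto simp: Fsp_mor_point[OF B x] filt_mkpt char_filter_def)
    then have "ch x (nec B (f c))"
      using character_mono[OF B ch_character[OF x]] mf_nec_le mf_closed nec_closed[OF A] nec_closed[OF B]
      by metis
    then show ?thesis using pointD(7)[OF B x] mf_closed cA by blast
  qed (use filt_Fsp_mor_iff x c in blast)
  then show "c \<in> carrier A" "f c \<in> filt B x" by auto
qed

text \<open>The inequalities for \<open>f\<close> transport the rejection of \<open>pos A\<close> at
  \<open>av\<close> and the inclusion of \<open>char_filter\<close>. Maximality of \<open>av\<close>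
  and minimality of the filter use the reverse inequalities, whence the strictness
  assumptions.\<close>

lemma Fsp_mor_prepoint:
  assumes x: "x \<in> points D B"
    and l: "lower D \<Longrightarrow> dia_strict A B f" and u: "upper D \<Longrightarrow> box_strict A B f"
  shows "Fsp_mor D A B f x \<in> prepoints D A"
proof -
  let ?y = "Fsp_mor D A B f x"
  note [simp] = nec_closed[OF A] pos_closed[OF A] nec_closed[OF B] pos_closed[OF B] mf_closed
    pointD(3)[OF B x] av_Fsp_mor_closed[OF x]
  note mono = character_mono[OF B ch_character[OF x]]
  have ch: "ch ?y \<in> characters A"
    using character_comp[OF modal_frame_is_frame[OF A] mf_frame_morphism ch_character[OF x]]
    by (simp add: ch_Fsp_mor[OF x])
  have ch_iff: "ch ?y c \<longleftrightarrow> ch x (f c)" if "c \<in> carrier A" for c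
    using that by (simp add: ch_Fsp_mor[OF x])
  have "?y = mkpt D (ch ?y) (av ?y) (filt A ?y)"
    by (simp only: Fsp_mor_point[OF B x] ch_mkpt av_mkpt filt_mkpt) (simp add: mkpt_def)
  moreover have "is_filter A (filt A ?y)"
    using is_filter_vimage[OF modal_frame_is_frame[OF A] modal_frame_is_frame[OF B]
        mf_frame_morphism pointD(4)[OF B x]] is_filter_char_filter[OF A ch]
    by (simp add: Fsp_mor_point[OF B x] filt_mkpt)
  moreover have "\<not> ch ?y (pos A (av ?y))"
  proof
    assume "ch ?y (pos A (av ?y))"
    then have "ch x (pos B (f (av ?y)))"
      using mono[OF _ _ mf_pos_le] ch_iff by simp
    then have "ch x (pos B (av x))"
      using mono[OF _ _ pos_mono[OF B _ _ av_Fsp_mor_le[OF x]]] by simp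
    then show False using pointD(6)[OF B x] by simp
  qed
  moreover have "char_filter A (ch ?y) \<subseteq> filt A ?y"
  proof (cases "triples D")
    case True
    then show ?thesis
      using filt_Fsp_mor_iff[OF True x] pointD(7)[OF B x] mono[OF _ _ mf_nec_le]
      by (auto simp: char_filter_def ch_iff)
  qed (simp add: Fsp_mor_point[OF B x] filt_mkpt)
  moreover have "largest_avoid A ?y" if "lower D"
    using l[OF that] pointD(8)[OF B x that] le_av_Fsp_mor_iff[OF x]
    by (auto simp: largest_avoid_def dia_strict_def ch_iff)
  moreover have "filt A ?y \<subseteq> char_filter A (ch ?y)" if "upper D"
    using u[OF that] pointD(9)[OF B x] that filt_Fsp_morD[OF x]
    by (auto simp: char_filter_def box_strict_def ch_iff)
  ultimately show ?thesis using ch by (simp add: mem_prepoints_iff[OF A])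
qed

context
  fixes D :: space_cat
  assumes l: "lower D \<Longrightarrow> dia_strict A B f" and u: "upper D \<Longrightarrow> box_strict A B f"
begin

text \<open>Coinduction on the image of all points: the tests on \<open>c\<close> at the image of
  \<open>x\<close> are tests on \<open>f c\<close> at \<open>x\<close>, and the image of a witness
  for \<open>f c\<close> is a witness for \<open>c\<close>.\<close>

lemma Fsp_mor_in_points:
  assumes "x \<in> points D B"
  shows "Fsp_mor D A B f x \<in> points D A"
proof -
  let ?F = "Fsp_mor D A B f"
  have "?F ` points D B \<subseteq> points D A"
  proof (rule points_subsetI[OF A])
    show "?F ` points D B \<subseteq> prepoints D A" using Fsp_mor_prepoint l u by blast
    have rel: "\<not> ch (?F y) (av (?F x)) \<and> (\<forall>d\<in>filt A (?F x). ch (?F y) d)"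
      if x: "x \<in> points D B" and y: "y \<in> points D B" and "pt_rel B x y" for x y
    proof -
      have "\<not> ch y (av x)" "\<forall>c\<in>filt B x. ch y c"
        using pt_rel_iff[OF B point_in_prepoints[OF x] point_in_prepoints[OF y]] that by auto
      moreover have "ch y (f (av (?F x))) \<Longrightarrow> ch y (av x)"
        using character_mono[OF B ch_character[OF y] _ _ av_Fsp_mor_le[OF x]]
          pointD(3)[OF B x] mf_closed av_Fsp_mor_closed[OF x] by blast
      ultimately show ?thesis
        using filt_Fsp_morD[OF x] av_Fsp_mor_closed[OF x] by (auto simp: ch_Fsp_mor[OF y])
    qed
    show "\<exists>y\<in>?F ` points D B. \<not> ch y (av z) \<and> (\<forall>d\<in>filt A z. ch y d) \<and> ch y c"
      if z: "z \<in> ?F ` points D B" and c: "c \<in> carrier A" "\<not> c \<sqsubseteq>\<^bsub>A\<^esub> av z" for z c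
    proof -
      obtain x where x: "x \<in> points D B" "z = ?F x" using z by blast
      then have "\<not> f c \<sqsubseteq>\<^bsub>B\<^esub> av x" using c le_av_Fsp_mor_iff by blast
      then obtain y where y: "y \<in> points D B" "pt_rel B x y" "ch y (f c)"
        using points_largest(2)[of B D] mf_closed[OF c(1)] x(1) 
        unfolding dia_witnessed_def by blast
      then have "ch (?F y) c" using c(1) by (simp add: ch_Fsp_mor)
      then show ?thesis using rel[OF x(1)] x(2) y by blast
    qed
    show "\<exists>y\<in>?F ` points D B. \<not> ch y (av z) \<and> (\<forall>d\<in>filt A z. ch y d) \<and> \<not> ch y c"
      if D: "triples D" and z: "z \<in> ?F ` points D B" and c: "c \<in> carrier A" "c \<notin> filt A z" for z c
    proof -
      obtain x where x: "x \<in> points D B" "z = ?F x" using z by blast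
      then have "f c \<notin> filt B x" using c filt_Fsp_mor_iff[OF D] by blast
      moreover have "x = Pt3 (ch x) (av x) (filt B x)"
        using pointD(1)[OF B x(1)] D by (simp add: mkpt_def)
      ultimately obtain y where y: "y \<in> points D B" "pt_rel B x y" "\<not> ch y (f c)"
        using points_largest(3)[of B D] mf_closed[OF c(1)] x(1) 
        unfolding box_witnessed_def by metis
      then have "\<not> ch (?F y) c" using c(1) by (simp add: ch_Fsp_mor)
      then show ?thesis using rel[OF x(1)] x(2) y by blast
    qed
  qed
  then show ?thesis using assms by blast
qed

text \<open>Yields continuity of \<open>Fsp_mor\<close> and is also the naturality square of
  \<open>phi_map\<close>.\<close>

lemma vimage_Fsp_mor:
  "c \<in> carrier A \<Longrightarrow> Fsp_mor D A B f -` phi D A c \<inter> points D B = phi D B (f c)"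
  by (auto simp: mem_phi_iff Fsp_mor_in_points ch_Fsp_mor)

text \<open>In the back clauses an open set is some \<open>phi D A c\<close>. Whether successors of
  the image point meet it, or leave it, depends on a test on \<open>f c\<close> at \<open>x\<close>,
  and this is the same question for \<open>phi D B (f c)\<close> and the successors of
  \<open>x\<close>.\<close>

lemma Fsp_mor_hom: "Fsp_mor D A B f \<in> sp_hom D (Fsp D B) (Fsp D A)"
proof -
  let ?F = "Fsp_mor D A B f"
  have ext: "?F \<in> extensional (topspace (topo (Fsp D B)))"
    by (simp add: topspace_Fsp[OF B] Fsp_mor_def)
  have cont: "continuous_map (topo (Fsp D B)) (topo (Fsp D A)) ?F"
    unfolding continuous_map_def topspace_Fsp[OF A] topspace_Fsp[OF B]
  proof (intro conjI allI impI)
    show "?F \<in> points D B \<rightarrow> points D A" using Fsp_mor_in_points by blast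
    fix U assume "openin (topo (Fsp D A)) U"
    then obtain c where c: "c \<in> carrier A" "U = phi D A c" by (auto simp: openin_Fsp_iff[OF A])
    have "{x \<in> points D B. ?F x \<in> U} = phi D B (f c)"
      using vimage_Fsp_mor[OF c(1)] c(2) by auto
    then show "openin (topo (Fsp D B)) {x \<in> points D B. ?F x \<in> U}"
      using mf_closed[OF c(1)] by (auto simp: openin_Fsp_iff[OF B])
  qed
  have acc: "(?F x, ?F y) \<in> acc (Fsp D A)" if xy: "(x, y) \<in> acc (Fsp D B)" for x y
  proof -
    have x: "x \<in> points D B" and y: "y \<in> points D B" and r: "\<not> ch y (av x)" "\<forall>c\<in>filt B x. ch y c"
      using xy by (auto simp: acc_Fsp_iff[OF B])
    have "ch y (f (av (?F x))) \<Longrightarrow> ch y (av x)"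
      using character_mono[OF B ch_character[OF y] _ _ av_Fsp_mor_le[OF x]]
        pointD(3)[OF B x] mf_closed av_Fsp_mor_closed[OF x] by blast
    then show ?thesis
      using x y r Fsp_mor_in_points filt_Fsp_morD[OF x] av_Fsp_mor_closed[OF x]
      by (auto simp: acc_Fsp_iff[OF A] ch_Fsp_mor[OF y])
  qed
  have dia: "\<exists>x'. (x, x') \<in> acc (Fsp D B) \<and> ?F x' \<in> U"
    if U: "openin (topo (Fsp D A)) U" and x: "x \<in> points D B" and y: "(?F x, y) \<in> acc (Fsp D A)" "y \<in> U"
    for U x y
  proof -
    obtain c where c: "c \<in> carrier A" "U = phi D A c" using U by (auto simp: openin_Fsp_iff[OF A])
    have "acc (Fsp D A) `` {?F x} \<inter> phi D A c \<noteq> {}" using y c by blast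
    then have "\<not> f c \<sqsubseteq>\<^bsub>B\<^esub> av x"
      using acc_Fsp_disjoint_phi_iff[OF A Fsp_mor_in_points[OF x] c(1)] le_av_Fsp_mor_iff[OF x c(1)]
      by simp
    then obtain x' where "(x, x') \<in> acc (Fsp D B)" "x' \<in> phi D B (f c)"
      using acc_Fsp_disjoint_phi_iff[OF B x mf_closed[OF c(1)]] by blast
    then show ?thesis using vimage_Fsp_mor[OF c(1)] c(2) by blast
  qed
  have box: "\<exists>x'. (x, x') \<in> acc (Fsp D B) \<and> ?F x' \<notin> U"
    if D: "triples D" and U: "openin (topo (Fsp D A)) U" and x: "x \<in> points D B"
      and y: "(?F x, y) \<in> acc (Fsp D A)" "y \<notin> U"
    for U x y
  proof -
    obtain c where c: "c \<in> carrier A" "U = phi D A c" using U by (auto simp: openin_Fsp_iff[OF A])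
    have "\<not> acc (Fsp D A) `` {?F x} \<subseteq> phi D A c" using y c by blast
    then have "f c \<notin> filt B x"
      using acc_Fsp_subset_phi_iff[OF A D Fsp_mor_in_points[OF x] c(1)] filt_Fsp_mor_iff[OF D x] c(1)
      by simp
    then obtain x' where "(x, x') \<in> acc (Fsp D B)" "x' \<notin> phi D B (f c)"
      using acc_Fsp_subset_phi_iff[OF B D x mf_closed[OF c(1)]] by blast
    moreover from this have "x' \<in> points D B" by (simp add: acc_Fsp_iff[OF B])
    ultimately show ?thesis using vimage_Fsp_mor[OF c(1)] c(2) by blast
  qed
  show ?thesis
    unfolding sp_hom_iff pq_morphisms_def p_morphisms_def topspace_Fsp[OF B]
    using ext cont acc dia box unfolding topspace_Fsp[OF B] by blast
qed

end

end

section \<open>Inverse images of open sets and the functor \<open>Omega_mor\<close>\<close>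

text \<open>The two directions are the forth and the back clause of p-morphisms. The equivalence
  matches the second component of \<open>eta\<close> at \<open>x\<close> with that at
  \<open>h x\<close>.\<close>

lemma p_morphism_vimage_disjoint_iff:
  assumes "rel_space X" and h: "h \<in> p_morphisms X Y" and x: "x \<in> topspace (topo X)" and V: "openin (topo Y) V"
  shows "acc X `` {x} \<inter> (h -` V \<inter> topspace (topo X)) = {} \<longleftrightarrow> acc Y `` {h x} \<inter> V = {}"
proof -
  have "\<exists>x'. (x, x') \<in> acc X \<and> h x' \<in> V" if "(h x, y) \<in> acc Y" "y \<in> V" for y
    using h x V that unfolding p_morphisms_def by blast
  moreover have "(h x, h x') \<in> acc Y" if "(x, x') \<in> acc X" for x'
    using h that unfolding p_morphisms_def by blast
  ultimately show ?thesis using assms(1) unfolding rel_space_def by blast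
qed

lemma pq_morphism_vimage_subset_iff:
  assumes "rel_space X" and h: "h \<in> pq_morphisms X Y" and x: "x \<in> topspace (topo X)" and V: "openin (topo Y) V"
  shows "acc X `` {x} \<subseteq> h -` V \<inter> topspace (topo X) \<longleftrightarrow> acc Y `` {h x} \<subseteq> V"
proof -
  have "\<exists>x'. (x, x') \<in> acc X \<and> h x' \<notin> V" if "(h x, y) \<in> acc Y" "y \<notin> V" for y
    using h x V that unfolding pq_morphisms_def by blast
  moreover have "(h x, h x') \<in> acc Y" if "(x, x') \<in> acc X" for x'
    using h that unfolding pq_morphisms_def p_morphisms_def by blast
  ultimately show ?thesis using assms(1) unfolding rel_space_def by blast
qed

lemma p_morphism_in_topspace:
  "h \<in> p_morphisms X Y \<Longrightarrow> x \<in> topspace (topo X) \<Longrightarrow> h x \<in> topspace (topo Y)"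
  by (auto simp: p_morphisms_def continuous_map_def)

lemma p_morphism_openin:
  assumes "h \<in> p_morphisms X Y" "openin (topo Y) V"
  shows "openin (topo X) (h -` V \<inter> topspace (topo X))"
proof -
  have "openin (topo X) {x \<in> topspace (topo X). h x \<in> V}"
    using assms by (auto simp: p_morphisms_def continuous_map_def)
  moreover have "{x \<in> topspace (topo X). h x \<in> V} = h -` V \<inter> topspace (topo X)" by blast
  ultimately show ?thesis by simp
qed

lemma Omega_mor_apply:
  "openin (topo Y) V \<Longrightarrow> Omega_mor X Y h V = h -` V \<inter> topspace (topo X)"
  by (simp add: Omega_mor_def)

lemma Omega_mor_frame_morphism:
  assumes h: "h \<in> p_morphisms X Y"
  shows "Omega_mor X Y h \<in> frame_morphisms (Omega Y) (Omega X)"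
proof -
  have "Omega_mor X Y h \<in> carrier (Omega Y) \<rightarrow>\<^sub>E carrier (Omega X)"
    using p_morphism_openin[OF h] by (auto simp: Omega_mor_def)
  moreover have "Omega_mor X Y h \<top>\<^bsub>Omega Y\<^esub> = \<top>\<^bsub>Omega X\<^esub>"
    using p_morphism_in_topspace[OF h] by (auto simp: top_Omega Omega_mor_apply)
  moreover have "Omega_mor X Y h (U \<sqinter>\<^bsub>Omega Y\<^esub> V) = Omega_mor X Y h U \<sqinter>\<^bsub>Omega X\<^esub> Omega_mor X Y h V"
    if "openin (topo Y) U" "openin (topo Y) V" for U V
    using that p_morphism_openin[OF h] by (auto simp: meet_Omega Omega_mor_apply openin_Int)
  moreover have "Omega_mor X Y h (\<Squnion>\<^bsub>Omega Y\<^esub>S) = \<Squnion>\<^bsub>Omega X\<^esub>(Omega_mor X Y h ` S)"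
    if S: "S \<subseteq> carrier (Omega Y)" for S
  proof -
    have "Omega_mor X Y h ` S = (\<lambda>V. h -` V \<inter> topspace (topo X)) ` S"
      using S by (intro image_cong) (auto simp: Omega_mor_apply)
    moreover have "(\<lambda>V. h -` V \<inter> topspace (topo X)) ` S \<subseteq> carrier (Omega X)"
      using S p_morphism_openin[OF h] by auto
    moreover have "openin (topo Y) (\<Union>S)" using S by auto
    ultimately show ?thesis using S by (auto simp: sup_Omega Omega_mor_apply)
  qed
  ultimately show ?thesis by (simp add: frame_morphisms_def)
qed

text \<open>Inverse image commutes with \<open>dia_rel\<close> on open sets, and with
  \<open>box_rel\<close> too for pq-morphisms. Only the interiors lose information, since the
  inverse image of an interior is merely contained in an interior; semicontinuity removes them and
  gives strictness.\<close>

lemma Omega_mor_hom: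
  assumes CD: "(C, D) \<in> dual_pairs" and X: "sp_obj D X" and Y: "sp_obj D Y" and h: "h \<in> sp_hom D X Y"
  shows "Omega_mor X Y h \<in> fr_hom C (Omega Y) (Omega X)"
proof -
  have hp: "h \<in> p_morphisms X Y" and hq: "triples D \<Longrightarrow> h \<in> pq_morphisms X Y"
    using h by (simp_all add: sp_hom_iff)
  have rX: "rel_space X" using X by (simp add: sp_obj_iff)
  let ?v = "\<lambda>V. h -` V \<inter> topspace (topo X)"
  have h_rel: "(h x, h x') \<in> acc Y" if "(x, x') \<in> acc X" for x x'
    using hp that unfolding p_morphisms_def by blast
  have box_le: "?v (box_rel Y V) \<subseteq> box_rel X (?v V)" for V
    using h_rel rX unfolding box_rel_def rel_space_def by blast
  have dia_eq: "?v (dia_rel Y V) = dia_rel X (?v V)" if V: "openin (topo Y) V" for V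
  proof (rule Set.set_eqI)
    show "x \<in> ?v (dia_rel Y V) \<longleftrightarrow> x \<in> dia_rel X (?v V)" for x
      using p_morphism_vimage_disjoint_iff[OF rX hp _ V, of x] p_morphism_in_topspace[OF hp, of x]
      by (cases "x \<in> topspace (topo X)") (simp_all add: dia_rel_def)
  qed
  have box_eq: "?v (box_rel Y V) = box_rel X (?v V)" if "triples D" and V: "openin (topo Y) V" for V
  proof (rule Set.set_eqI)
    show "x \<in> ?v (box_rel Y V) \<longleftrightarrow> x \<in> box_rel X (?v V)" for x
      using pq_morphism_vimage_subset_iff[OF rX hq[OF that(1)] _ V, of x]
        p_morphism_in_topspace[OF hp, of x]
      by (cases "x \<in> topspace (topo X)") (simp_all add: box_rel_def)
  qed
  have int: "?v (topo Y interior_of W) \<subseteq> topo X interior_of W'" if "?v W \<subseteq> W'" for W W'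
    using that interior_of_subset[of "topo Y" W] p_morphism_openin[OF hp]
    by (intro interior_of_maximal) auto
  have "Omega_mor X Y h (nec (Omega Y) V) \<subseteq> nec (Omega X) (Omega_mor X Y h V) \<and>
      Omega_mor X Y h (pos (Omega Y) V) \<subseteq> pos (Omega X) (Omega_mor X Y h V)"
    if V: "openin (topo Y) V" for V
    using int[OF box_le] int[OF equalityD1[OF dia_eq[OF V]]] by (simp add: Omega_mor_apply V)
  then have mf: "Omega_mor X Y h \<in> mf_morphisms (Omega Y) (Omega X)"
    using Omega_mor_frame_morphism[OF hp] by (simp add: mf_morphisms_def)
  have "dia_strict (Omega Y) (Omega X) (Omega_mor X Y h)" if "lower D"
  proof -
    have lX: "lsc X" and lY: "lsc Y" using X Y that by (simp_all add: sp_obj_iff)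
    show ?thesis
      unfolding dia_strict_def
    proof
      fix V assume "V \<in> carrier (Omega Y)"
      then have V: "openin (topo Y) V" by simp
      show "Omega_mor X Y h (pos (Omega Y) V) = pos (Omega X) (Omega_mor X Y h V)"
        using lY[unfolded lsc_def, rule_format, OF V] V p_morphism_openin[OF hp V]
        by (simp add: pos_Omega_lsc lX lY Omega_mor_apply dia_eq del: pos_Omega)
    qed
  qed
  moreover have "box_strict (Omega Y) (Omega X) (Omega_mor X Y h)" if "upper D"
  proof -
    have uX: "usc X" and uY: "usc Y" using X Y that by (simp_all add: sp_obj_iff)
    show ?thesis
      unfolding box_strict_def
    proof
      fix V assume "V \<in> carrier (Omega Y)"
      then have V: "openin (topo Y) V" by simp
      show "Omega_mor X Y h (nec (Omega Y) V) = nec (Omega X) (Omega_mor X Y h V)"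
        using uY[unfolded usc_def, rule_format, OF V] V p_morphism_openin[OF hp V]
        by (simp add: nec_Omega_usc uX uY Omega_mor_apply box_eq upper_triples that del: nec_Omega)
    qed
  qed
  ultimately show ?thesis using mf by (simp add: dual_pairs_frame_hom[OF CD])
qed

section \<open>Closure of the hom sets under identities and composition\<close>

lemma mf_morphism_id:
  assumes A: "modal_frame A"
  shows "fr_id A \<in> mf_morphisms A A"
proof -
  interpret complete_lattice A by (rule modal_frame_complete_lattice[OF A])
  show ?thesis
    using frame_morphism_id[OF modal_frame_is_frame[OF A]] nec_closed[OF A] pos_closed[OF A]
    by (simp add: mf_morphisms_def fr_id_def)
qed

lemma fr_id_hom:
  assumes "(C, D) \<in> dual_pairs" "modal_frame A"
  shows "fr_id A \<in> fr_hom C A A"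
  using mf_morphism_id[OF assms(2)] nec_closed[OF assms(2)] pos_closed[OF assms(2)]
  by (simp add: dual_pairs_frame_hom[OF assms(1)] dia_strict_def box_strict_def fr_id_def)

lemma fr_comp_hom:
  assumes CD: "(C, D) \<in> dual_pairs" and A: "modal_frame A" and B: "modal_frame B" and E: "modal_frame E"
    and f: "f \<in> fr_hom C A B" and g: "g \<in> fr_hom C B E"
  shows "fr_comp A g f \<in> fr_hom C A E"
proof -
  have fm: "f \<in> mf_morphisms A B" and gm: "g \<in> mf_morphisms B E"
    using f g by (simp_all add: dual_pairs_frame_hom[OF CD])
  note ff = mf_frame_morphism[OF A B fm] and gf = mf_frame_morphism[OF B E gm]
  note closed = nec_closed[OF A] pos_closed[OF A] nec_closed[OF B] pos_closed[OF B]
    nec_closed[OF E] pos_closed[OF E] mf_closed[OF A B fm] mf_closed[OF B E gm]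
  note mono = frame_morphism_mono[OF modal_frame_is_frame[OF B] modal_frame_is_frame[OF E] gf]
  have "g (f (nec A c)) \<sqsubseteq>\<^bsub>E\<^esub> nec E (g (f c)) \<and> g (f (pos A c)) \<sqsubseteq>\<^bsub>E\<^esub> pos E (g (f c))"
    if c: "c \<in> carrier A" for c
  proof -
    interpret E: complete_lattice E by (rule modal_frame_complete_lattice[OF E])
    have "g (f (nec A c)) \<sqsubseteq>\<^bsub>E\<^esub> g (nec B (f c))" "g (f (pos A c)) \<sqsubseteq>\<^bsub>E\<^esub> g (pos B (f c))"
      using mono[OF _ _ mf_nec_le[OF A B fm c]] mono[OF _ _ mf_pos_le[OF A B fm c]] c
      by (simp_all add: closed)
    then show ?thesis
      using E.le_trans[OF _ mf_nec_le[OF B E gm, of "f c"]] E.le_trans[OF _ mf_pos_le[OF B E gm, of "f c"]] c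
      by (simp add: closed)
  qed
  then have "fr_comp A g f \<in> mf_morphisms A E"
    using frame_morphism_compose[OF modal_frame_is_frame[OF A] ff gf]
    by (simp add: mf_morphisms_def fr_comp_def compose_def closed)
  then show ?thesis
    using f g
    by (simp add: dual_pairs_frame_hom[OF CD] dia_strict_def box_strict_def fr_comp_def compose_def closed)
qed

lemma sp_id_hom:
  assumes "rel_space X"
  shows "sp_id X \<in> sp_hom D X X"
proof -
  have sp: "x \<in> topspace (topo X) \<and> y \<in> topspace (topo X)" if "(x, y) \<in> acc X" for x y
    using assms that by (auto simp: rel_space_def)
  have "sp_id X \<in> extensional (topspace (topo X))" by (simp add: sp_id_def)
  moreover have "continuous_map (topo X) (topo X) (sp_id X)"
    by (rule continuous_map_eq[OF continuous_map_id]) (simp add: sp_id_def)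
  moreover have "(sp_id X x, sp_id X y) = (x, y)" if "(x, y) \<in> acc X" for x y
    using sp[OF that] by (simp add: sp_id_def)
  moreover have "sp_id X x = x" if "x \<in> topspace (topo X)" for x using that by (simp add: sp_id_def)
  ultimately show ?thesis
    unfolding sp_hom_iff pq_morphisms_def p_morphisms_def using sp by (auto; metis)
qed

lemma sp_comp_hom:
  assumes X: "rel_space X" and Y: "rel_space Y" and h: "h \<in> sp_hom D X Y" and k: "k \<in> sp_hom D Y Z"
  shows "sp_comp X k h \<in> sp_hom D X Z"
proof -
  have hp: "h \<in> p_morphisms X Y" and hq: "triples D \<Longrightarrow> h \<in> pq_morphisms X Y"
    and kp: "k \<in> p_morphisms Y Z" and kq: "triples D \<Longrightarrow> k \<in> pq_morphisms Y Z"
    using h k by (simp_all add: sp_hom_iff)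
  let ?c = "sp_comp X k h"
  have sp: "x \<in> topspace (topo X) \<and> y \<in> topspace (topo X)" if "(x, y) \<in> acc X" for x y
    using X that by (auto simp: rel_space_def)
  have c: "?c x = k (h x)" if "x \<in> topspace (topo X)" for x
    using that by (simp add: sp_comp_def compose_def)
  note hY = p_morphism_in_topspace[OF hp]
  have ext: "?c \<in> extensional (topspace (topo X))" by (simp add: sp_comp_def compose_def)
  have cont: "continuous_map (topo X) (topo Z) ?c"
  proof (rule continuous_map_eq)
    show "continuous_map (topo X) (topo Z) (k \<circ> h)"
      using hp kp by (auto simp: p_morphisms_def intro: continuous_map_compose)
  qed (simp add: c)
  have acc: "(?c x, ?c y) \<in> acc Z" if "(x, y) \<in> acc X" for x y
  proof -
    have "(h x, h y) \<in> acc Y" using hp that unfolding p_morphisms_def by blast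
    then have "(k (h x), k (h y)) \<in> acc Z" using kp unfolding p_morphisms_def by blast
    then show ?thesis using sp[OF that] by (simp add: c)
  qed
  have dia: "\<exists>x'. (x, x') \<in> acc X \<and> ?c x' \<in> U"
    if U: "openin (topo Z) U" and x: "x \<in> topspace (topo X)" and z: "(?c x, z) \<in> acc Z" "z \<in> U" for U x z
  proof -
    obtain y where y: "(h x, y) \<in> acc Y" "k y \<in> U"
      using kp U hY[OF x] z unfolding p_morphisms_def c[OF x] by blast
    \<comment> \<open>The back clause of \<open>h\<close> reaches open sets rather than points, so
      it is applied to the inverse image of \<open>U\<close> under \<open>k\<close>, open by
      continuity of \<open>k\<close>.\<close>
    then have "y \<in> k -` U \<inter> topspace (topo Y)" using Y by (auto simp: rel_space_def)
    then obtain x' where "(x, x') \<in> acc X" "h x' \<in> k -` U \<inter> topspace (topo Y)"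
      using hp p_morphism_openin[OF kp U] x y(1) unfolding p_morphisms_def by blast
    then show ?thesis using c sp by auto
  qed
  have box: "\<exists>x'. (x, x') \<in> acc X \<and> ?c x' \<notin> U"
    if D: "triples D" and U: "openin (topo Z) U" and x: "x \<in> topspace (topo X)"
      and z: "(?c x, z) \<in> acc Z" "z \<notin> U" for U x z
  proof -
    obtain y where y: "(h x, y) \<in> acc Y" "k y \<notin> U"
      using kq[OF D] U hY[OF x] z unfolding pq_morphisms_def c[OF x] by blast
    then obtain x' where x': "(x, x') \<in> acc X" "h x' \<notin> k -` U \<inter> topspace (topo Y)"
      using hq[OF D] p_morphism_openin[OF kp U] x unfolding pq_morphisms_def by blast
    then show ?thesis using c sp hY by auto
  qed
  show ?thesis
    unfolding sp_hom_iff pq_morphisms_def p_morphisms_def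
    using ext cont acc dia box by blast
qed

section \<open>Equality of points and functoriality\<close>

lemma Omega_mor_sp_id: "Omega_mor X X (sp_id X) = fr_id (Omega X)"
proof -
  have "sp_id X -` U \<inter> topspace (topo X) = U" if "openin (topo X) U" for U
    using openin_subset[OF that] by (auto simp: sp_id_def)
  then show ?thesis by (auto simp: Omega_mor_def fr_id_def restrict_def fun_eq_iff)
qed

lemma Omega_mor_sp_comp:
  assumes h: "h \<in> sp_hom D X Y" and k: "k \<in> sp_hom D Y Z"
  shows "Omega_mor X Z (sp_comp X k h) = fr_comp (Omega Z) (Omega_mor X Y h) (Omega_mor Y Z k)"
proof
  fix W
  have hp: "h \<in> p_morphisms X Y" and kp: "k \<in> p_morphisms Y Z"
    using h k by (simp_all add: sp_hom_iff)
  show "Omega_mor X Z (sp_comp X k h) W = fr_comp (Omega Z) (Omega_mor X Y h) (Omega_mor Y Z k) W"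
  proof (cases "openin (topo Z) W")
    case True
    then show ?thesis
      using p_morphism_openin[OF kp True] p_morphism_in_topspace[OF hp]
      by (auto simp: fr_comp_def compose_def Omega_mor_apply sp_comp_def)
  next
    case False
    then show ?thesis by (simp add: fr_comp_def compose_def Omega_mor_def)
  qed
qed

text \<open>Tests on the carrier suffice: characters are extensional, \<open>av\<close> is fixed by
  the elements below it, and filters consist of carrier elements. For pairs the character already
  determines \<open>filt\<close>.\<close>

lemma point_eqI:
  assumes A: "modal_frame A" and x: "x \<in> points D A" and y: "y \<in> points D A"
    and ch: "\<And>c. c \<in> carrier A \<Longrightarrow> ch x c \<longleftrightarrow> ch y c"
    and av: "\<And>c. c \<in> carrier A \<Longrightarrow> c \<sqsubseteq>\<^bsub>A\<^esub> av x \<longleftrightarrow> c \<sqsubseteq>\<^bsub>A\<^esub> av y"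
    and filt: "\<And>c. triples D \<Longrightarrow> c \<in> carrier A \<Longrightarrow> c \<in> filt A x \<longleftrightarrow> c \<in> filt A y"
  shows "x = y"
proof -
  have "ch x \<in> extensional (carrier A)" "ch y \<in> extensional (carrier A)"
    using ch_character x y by (auto simp: character_iff)
  then have 1: "ch x = ch y" using ch by (auto intro: extensionalityI)
  have 2: "av x = av y"
    by (rule frame_eqI[OF modal_frame_is_frame[OF A] pointD(3)[OF A x] pointD(3)[OF A y] av])
  have 3: "filt A x = filt A y" if "triples D"
    using filt[OF that] pointD(5)[OF A x] pointD(5)[OF A y] by blast
  have "mkpt D (ch x) (av x) (filt A x) = mkpt D (ch y) (av y) (filt A y)"
    using 1 2 3 by (cases "triples D") (simp_all add: mkpt_def)
  then show ?thesis using pointD(1)[OF A x] pointD(1)[OF A y] by simp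
qed

lemma Fsp_mor_fr_id:
  assumes CD: "(C, D) \<in> dual_pairs" and A: "modal_frame A"
  shows "Fsp_mor D A A (fr_id A) = sp_id (Fsp D A)"
proof
  fix x
  have f: "fr_id A \<in> mf_morphisms A A" "lower D \<Longrightarrow> dia_strict A A (fr_id A)"
      "upper D \<Longrightarrow> box_strict A A (fr_id A)"
    using fr_id_hom[OF CD A] by (simp_all add: dual_pairs_frame_hom[OF CD])
  show "Fsp_mor D A A (fr_id A) x = sp_id (Fsp D A) x"
  proof (cases "x \<in> points D A")
    case x: True
    have "Fsp_mor D A A (fr_id A) x = x"
    proof (rule point_eqI[OF A Fsp_mor_in_points[OF A A f x] x])
      fix c assume c: "c \<in> carrier A"
      then have id: "fr_id A c = c" by (simp add: fr_id_def)
      show "ch (Fsp_mor D A A (fr_id A) x) c \<longleftrightarrow> ch x c"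
        using c id by (simp add: ch_Fsp_mor[OF A A f(1) x])
      show "c \<sqsubseteq>\<^bsub>A\<^esub> av (Fsp_mor D A A (fr_id A) x) \<longleftrightarrow> c \<sqsubseteq>\<^bsub>A\<^esub> av x"
        using le_av_Fsp_mor_iff[OF A A f(1) x c] id by simp
      show "c \<in> filt A (Fsp_mor D A A (fr_id A) x) \<longleftrightarrow> c \<in> filt A x" if "triples D"
        using filt_Fsp_mor_iff[OF A A f(1) that x] c id by simp
    qed
    then show ?thesis using x by (simp add: sp_id_def topspace_Fsp[OF A])
  next
    case False
    then show ?thesis by (simp add: sp_id_def topspace_Fsp[OF A] Fsp_mor_def)
  qed
qed

text \<open>Both sides give the same tests, so the composition of right adjoints is obtained from
  \<open>le_av_Fsp_mor_iff\<close> without computing nested suprema.\<close>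

lemma Fsp_mor_fr_comp:
  assumes CD: "(C, D) \<in> dual_pairs" and A: "modal_frame A" and B: "modal_frame B" and E: "modal_frame E"
    and f: "f \<in> fr_hom C A B" and g: "g \<in> fr_hom C B E"
  shows "Fsp_mor D A E (fr_comp A g f) = sp_comp (Fsp D E) (Fsp_mor D A B f) (Fsp_mor D B E g)"
proof
  fix x
  have F: "f \<in> mf_morphisms A B" "lower D \<Longrightarrow> dia_strict A B f" "upper D \<Longrightarrow> box_strict A B f"
    and G: "g \<in> mf_morphisms B E" "lower D \<Longrightarrow> dia_strict B E g" "upper D \<Longrightarrow> box_strict B E g"
    using f g by (simp_all add: dual_pairs_frame_hom[OF CD])
  have GF: "fr_comp A g f \<in> mf_morphisms A E" "lower D \<Longrightarrow> dia_strict A E (fr_comp A g f)"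
      "upper D \<Longrightarrow> box_strict A E (fr_comp A g f)"
    using fr_comp_hom[OF CD A B E f g] by (simp_all add: dual_pairs_frame_hom[OF CD])
  show "Fsp_mor D A E (fr_comp A g f) x = sp_comp (Fsp D E) (Fsp_mor D A B f) (Fsp_mor D B E g) x"
  proof (cases "x \<in> points D E")
    case x: True
    let ?y = "Fsp_mor D B E g x"
    have y: "?y \<in> points D B" by (rule Fsp_mor_in_points[OF B E G x])
    have "Fsp_mor D A E (fr_comp A g f) x = Fsp_mor D A B f ?y"
    proof (rule point_eqI[OF A Fsp_mor_in_points[OF A E GF x] Fsp_mor_in_points[OF A B F y]])
      fix c assume c: "c \<in> carrier A"
      then have gf: "fr_comp A g f c = g (f c)" by (simp add: fr_comp_def compose_def)
      have fc: "f c \<in> carrier B" by (rule mf_closed[OF A B F(1) c])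
      show "ch (Fsp_mor D A E (fr_comp A g f) x) c \<longleftrightarrow> ch (Fsp_mor D A B f ?y) c"
        using c fc gf by (simp add: ch_Fsp_mor[OF A E GF(1) x] ch_Fsp_mor[OF A B F(1) y]
            ch_Fsp_mor[OF B E G(1) x])
      show "c \<sqsubseteq>\<^bsub>A\<^esub> av (Fsp_mor D A E (fr_comp A g f) x) \<longleftrightarrow> c \<sqsubseteq>\<^bsub>A\<^esub> av (Fsp_mor D A B f ?y)"
        using le_av_Fsp_mor_iff[OF A E GF(1) x c] le_av_Fsp_mor_iff[OF A B F(1) y c]
          le_av_Fsp_mor_iff[OF B E G(1) x fc] gf by simp
      show "c \<in> filt A (Fsp_mor D A E (fr_comp A g f) x) \<longleftrightarrow> c \<in> filt A (Fsp_mor D A B f ?y)"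
        if D: "triples D"
        using filt_Fsp_mor_iff[OF A E GF(1) D x] filt_Fsp_mor_iff[OF A B F(1) D y]
          filt_Fsp_mor_iff[OF B E G(1) D x] gf fc by simp
    qed
    then show ?thesis using x by (simp add: sp_comp_def compose_def topspace_Fsp[OF E])
  next
    case False
    then show ?thesis by (simp add: sp_comp_def compose_def topspace_Fsp[OF E] Fsp_mor_def)
  qed
qed

section \<open>The unit\<close>

lemma eta_point:
  "x \<in> topspace (topo X) \<Longrightarrow> eta D X x = mkpt D (\<lambda>U\<in>carrier (Omega X). x \<in> U)
    (\<Union>{U. openin (topo X) U \<and> acc X `` {x} \<inter> U = {}})
    {U. openin (topo X) U \<and> acc X `` {x} \<subseteq> U}"
  by (simp add: eta_def mkpt_def triples_def Let_def)

lemma ch_eta: "x \<in> topspace (topo X) \<Longrightarrow> ch (eta D X x) = (\<lambda>U\<in>carrier (Omega X). x \<in> U)"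
  by (simp add: eta_point)

lemma subset_av_eta_iff:
  "x \<in> topspace (topo X) \<Longrightarrow> openin (topo X) U \<Longrightarrow>
    U \<subseteq> av (eta D X x) \<longleftrightarrow> acc X `` {x} \<inter> U = {}"
  by (simp add: eta_point) blast

lemma av_eta_disjoint:
  "x \<in> topspace (topo X) \<Longrightarrow> acc X `` {x} \<inter> av (eta D X x) = {}"
  by (simp add: eta_point) blast

lemma filt_eta_iff:
  "triples D \<Longrightarrow> x \<in> topspace (topo X) \<Longrightarrow>
    U \<in> filt (Omega X) (eta D X x) \<longleftrightarrow> openin (topo X) U \<and> acc X `` {x} \<subseteq> U"
  by (simp add: eta_point filt_mkpt)

text \<open>For pairs membership says that \<open>x\<close> is in the interior of
  \<open>box_rel X U\<close>, which is stronger than having all successors in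
  \<open>U\<close>.\<close>

lemma filt_etaD:
  assumes "rel_space X" and x: "x \<in> topspace (topo X)" and U: "U \<in> filt (Omega X) (eta D X x)"
  shows "openin (topo X) U" "acc X `` {x} \<subseteq> U"
proof -
  have "openin (topo X) U \<and> acc X `` {x} \<subseteq> U"
  proof (cases "triples D")
    case False
    then show ?thesis
      using U interior_of_subset[of "topo X" "box_rel X U"]
      by (auto simp: eta_point[OF x] filt_mkpt char_filter_def box_rel_def)
  next
    case True
    then show ?thesis using U x by (simp add: filt_eta_iff)
  qed
  then show "openin (topo X) U" "acc X `` {x} \<subseteq> U" by auto
qed

lemma eta_character:
  assumes x: "x \<in> topspace (topo X)"
  shows "(\<lambda>U\<in>carrier (Omega X). x \<in> U) \<in> characters (Omega X)"
proof -
  have "(\<Squnion>\<^bsub>Omega X\<^esub>S) = \<Union>S \<and> openin (topo X) (\<Union>S)" if "S \<subseteq> {U. openin (topo X) U}" for S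
    using that sup_Omega[of S X] by auto
  then show ?thesis
    using x by (auto simp: character_iff top_Omega meet_Omega openin_Int)
qed

text \<open>An interior is contained in its set, which gives the basic conditions. Semicontinuity
  makes \<open>dia_rel X U\<close> or \<open>box_rel X U\<close> open, so that rejecting or
  accepting the modal open set describes the successors of \<open>x\<close> exactly; this gives the
  extremal conditions.\<close>

lemma eta_prepoint:
  assumes X: "sp_obj D X" and x: "x \<in> topspace (topo X)"
  shows "eta D X x \<in> prepoints D (Omega X)"
proof -
  let ?y = "eta D X x" and ?A = "Omega X"
  have rX: "rel_space X" and l: "lower D \<Longrightarrow> lsc X" and u: "upper D \<Longrightarrow> usc X"
    using X by (simp_all add: sp_obj_iff)
  have A: "modal_frame ?A" by (rule modal_frame_Omega[OF rX])
  have ch: "ch ?y \<in> characters ?A" using eta_character[OF x] by (simp add: ch_eta[OF x])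
  have ch_iff: "ch ?y U \<longleftrightarrow> x \<in> U" if "openin (topo X) U" for U using that by (simp add: ch_eta[OF x])
  have av: "openin (topo X) (av ?y)" by (auto simp: eta_point[OF x])
  have "?y = mkpt D (ch ?y) (av ?y) (filt ?A ?y)"
    by (simp only: eta_point[OF x] ch_mkpt av_mkpt filt_mkpt) (simp add: mkpt_def)
  moreover have "is_filter ?A (filt ?A ?y)"
  proof (cases "triples D")
    case True
    have "acc X `` {x} \<subseteq> topspace (topo X)" using rX by (auto simp: rel_space_def)
    then show ?thesis
      by (auto simp: is_filter_def eta_point[OF x] filt_mkpt True meet_Omega openin_Int)
  qed (use is_filter_char_filter[OF A ch] in \<open>simp add: eta_point[OF x] filt_mkpt\<close>)
  moreover have "\<not> ch ?y (pos ?A (av ?y))"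
  proof -
    have "x \<notin> dia_rel X (av ?y)" by (simp add: dia_rel_def av_eta_disjoint[OF x])
    then show ?thesis using interior_of_subset[of "topo X" "dia_rel X (av ?y)"] ch_iff by auto
  qed
  moreover have "char_filter ?A (ch ?y) \<subseteq> filt ?A ?y"
  proof (cases "triples D")
    case True
    show ?thesis
    proof
      fix U assume "U \<in> char_filter ?A (ch ?y)"
      then have "openin (topo X) U" "x \<in> box_rel X U"
        using interior_of_subset[of "topo X" "box_rel X U"] by (auto simp: char_filter_def ch_iff)
      then show "U \<in> filt ?A ?y" by (simp add: filt_eta_iff[OF True x] box_rel_def)
    qed
  qed (simp add: eta_point[OF x] filt_mkpt)
  moreover have "largest_avoid ?A ?y" if "lower D"
    unfolding largest_avoid_def
  proof (intro ballI impI)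
    fix U assume "U \<in> carrier ?A" and n: "\<not> ch ?y (pos ?A U)"
    then have U: "openin (topo X) U" by simp
    have "openin (topo X) (dia_rel X U)" using l[OF that] U by (simp add: lsc_def)
    then have "x \<notin> dia_rel X U" using n ch_iff by (simp add: interior_of_openin)
    then show "U \<sqsubseteq>\<^bsub>?A\<^esub> av ?y" using x by (simp add: subset_av_eta_iff[OF x U] dia_rel_def)
  qed
  moreover have "filt ?A ?y \<subseteq> char_filter ?A (ch ?y)" if "upper D"
  proof
    fix U assume "U \<in> filt ?A ?y"
    then have U: "openin (topo X) U" and "x \<in> box_rel X U"
      using filt_etaD[OF rX x] x by (auto simp: box_rel_def)
    moreover have "openin (topo X) (box_rel X U)" using u[OF that] U by (simp add: usc_def)
    ultimately show "U \<in> char_filter ?A (ch ?y)"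
      by (simp add: char_filter_def ch_iff interior_of_openin)
  qed
  ultimately show ?thesis using ch av by (simp add: mem_prepoints_iff[OF A])
qed

lemma eta_related:
  assumes "rel_space X" and xy: "(x, y) \<in> acc X"
  shows "\<not> ch (eta D X y) (av (eta D X x)) \<and> (\<forall>U\<in>filt (Omega X) (eta D X x). ch (eta D X y) U)"
proof -
  have x: "x \<in> topspace (topo X)" and y: "y \<in> topspace (topo X)"
    using assms by (auto simp: rel_space_def)
  have "openin (topo X) (av (eta D X x))" by (auto simp: eta_point[OF x])
  moreover have "y \<notin> av (eta D X x)" using av_eta_disjoint[OF x] xy by blast
  moreover have "openin (topo X) U \<and> y \<in> U" if "U \<in> filt (Omega X) (eta D X x)" for U
    using filt_etaD[OF assms(1) x that] xy by blast
  ultimately show ?thesis by (simp add: ch_eta[OF y])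
qed

text \<open>Coinduction on the image of the whole space, the witnesses being images of actual
  successors.\<close>

lemma eta_in_points:
  assumes X: "sp_obj D X" and x: "x \<in> topspace (topo X)"
  shows "eta D X x \<in> points D (Omega X)"
proof -
  have rX: "rel_space X" using X by (simp add: sp_obj_iff)
  have sp: "y \<in> topspace (topo X)" if "(x, y) \<in> acc X" for x y
    using rX that by (auto simp: rel_space_def)
  have "eta D X ` topspace (topo X) \<subseteq> points D (Omega X)"
  proof (rule points_subsetI[OF modal_frame_Omega[OF rX]])
    show "eta D X ` topspace (topo X) \<subseteq> prepoints D (Omega X)" using eta_prepoint[OF X] by blast
    fix z U assume "z \<in> eta D X ` topspace (topo X)" and "U \<in> carrier (Omega X)"
    then obtain x where x: "x \<in> topspace (topo X)" "z = eta D X x" and U: "openin (topo X) U" by auto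
    let ?P = "\<lambda>y. \<not> ch y (av z) \<and> (\<forall>d\<in>filt (Omega X) z. ch y d)"
    have rel: "?P (eta D X y)" if "(x, y) \<in> acc X" for y using eta_related[OF rX that] x(2) by blast
    show "\<exists>y\<in>eta D X ` topspace (topo X). \<not> ch y (av z) \<and> (\<forall>d\<in>filt (Omega X) z. ch y d) \<and> ch y U"
      if "\<not> U \<sqsubseteq>\<^bsub>Omega X\<^esub> av z"
    proof -
      have "acc X `` {x} \<inter> U \<noteq> {}" using that x(2) by (simp add: subset_av_eta_iff[OF x(1) U])
      then obtain y where y: "(x, y) \<in> acc X" "y \<in> U" by blast
      then have "ch (eta D X y) U" using U by (simp add: ch_eta[OF sp[OF y(1)]])
      then show ?thesis using rel[OF y(1)] sp[OF y(1)] by blast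
    qed
    show "\<exists>y\<in>eta D X ` topspace (topo X). \<not> ch y (av z) \<and> (\<forall>d\<in>filt (Omega X) z. ch y d) \<and> \<not> ch y U"
      if D: "triples D" and "U \<notin> filt (Omega X) z"
    proof -
      have "\<not> acc X `` {x} \<subseteq> U" using that(2) U x(2) by (simp add: filt_eta_iff[OF D x(1)])
      then obtain y where y: "(x, y) \<in> acc X" "y \<notin> U" by blast
      then have "\<not> ch (eta D X y) U" using U by (simp add: ch_eta[OF sp[OF y(1)]])
      then show ?thesis using rel[OF y(1)] sp[OF y(1)] by blast
    qed
  qed
  then show ?thesis using x by blast
qed

text \<open>Recovers every open set from its \<open>phi\<close>: the source of continuity of
  \<open>eta\<close> and of the left inverse of \<open>phi_map\<close> on
  \<open>Omega X\<close>.\<close>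

lemma vimage_eta:
  assumes "sp_obj D X" "openin (topo X) U"
  shows "eta D X -` phi D (Omega X) U \<inter> topspace (topo X) = U"
  using openin_subset[OF assms(2)] assms
  by (auto simp: mem_phi_iff ch_eta eta_in_points)

lemma eta_hom:
  assumes X: "sp_obj D X"
  shows "eta D X \<in> sp_hom D X (Fsp D (Omega X))"
proof -
  have rX: "rel_space X" using X by (simp add: sp_obj_iff)
  have A: "modal_frame (Omega X)" by (rule modal_frame_Omega[OF rX])
  have sp: "x \<in> topspace (topo X)" "y \<in> topspace (topo X)" if "(x, y) \<in> acc X" for x y
    using rX that by (auto simp: rel_space_def)
  have ext: "eta D X \<in> extensional (topspace (topo X))" by (simp add: eta_def)
  have cont: "continuous_map (topo X) (topo (Fsp D (Omega X))) (eta D X)"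
    unfolding continuous_map_def topspace_Fsp[OF A]
  proof (intro conjI allI impI)
    show "eta D X \<in> topspace (topo X) \<rightarrow> points D (Omega X)" using eta_in_points[OF X] by blast
    fix V assume "openin (topo (Fsp D (Omega X))) V"
    then obtain U where U: "openin (topo X) U" "V = phi D (Omega X) U" by (auto simp: openin_Fsp_iff[OF A])
    have "{x \<in> topspace (topo X). eta D X x \<in> V} = U" using vimage_eta[OF X U(1)] U(2) by auto
    then show "openin (topo X) {x \<in> topspace (topo X). eta D X x \<in> V}" using U(1) by simp
  qed
  have acc: "(eta D X x, eta D X y) \<in> acc (Fsp D (Omega X))" if "(x, y) \<in> acc X" for x y
    using eta_related[OF rX that] eta_in_points[OF X] sp[OF that] by (simp add: acc_Fsp_iff[OF A])
  have dia: "\<exists>x'. (x, x') \<in> acc X \<and> eta D X x' \<in> V"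
    if V: "openin (topo (Fsp D (Omega X))) V" and x: "x \<in> topspace (topo X)"
      and y: "(eta D X x, y) \<in> acc (Fsp D (Omega X))" "y \<in> V" for V x y
  proof -
    obtain U where U: "openin (topo X) U" "V = phi D (Omega X) U" using V by (auto simp: openin_Fsp_iff[OF A])
    have "acc (Fsp D (Omega X)) `` {eta D X x} \<inter> V \<noteq> {}" using y by blast
    then have "\<not> U \<subseteq> av (eta D X x)"
      using acc_Fsp_disjoint_phi_iff[OF A eta_in_points[OF X x], of U] U by simp
    then obtain x' where x': "(x, x') \<in> acc X" "x' \<in> U" using subset_av_eta_iff[OF x U(1)] by blast
    then have "eta D X x' \<in> V" using vimage_eta[OF X U(1)] U(2) by blast
    then show ?thesis using x' by blast
  qed
  have box: "\<exists>x'. (x, x') \<in> acc X \<and> eta D X x' \<notin> V"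
    if D: "triples D" and V: "openin (topo (Fsp D (Omega X))) V" and x: "x \<in> topspace (topo X)"
      and y: "(eta D X x, y) \<in> acc (Fsp D (Omega X))" "y \<notin> V" for V x y
  proof -
    obtain U where U: "openin (topo X) U" "V = phi D (Omega X) U" using V by (auto simp: openin_Fsp_iff[OF A])
    have "\<not> acc (Fsp D (Omega X)) `` {eta D X x} \<subseteq> V" using y by blast
    then have "U \<notin> filt (Omega X) (eta D X x)"
      using acc_Fsp_subset_phi_iff[OF A D eta_in_points[OF X x], of U] U by simp
    then obtain x' where x': "(x, x') \<in> acc X" "x' \<notin> U" using filt_eta_iff[OF D x] U(1) by blast
    then have "eta D X x' \<notin> V" using vimage_eta[OF X U(1)] U(2) sp(2)[OF x'(1)] by blast
    then show ?thesis using x' by blast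
  qed
  show ?thesis
    unfolding sp_hom_iff pq_morphisms_def p_morphisms_def
    using ext cont acc dia box by blast
qed

text \<open>Under the second and third tests this becomes the equivalences for inverse images under
  p-morphisms and pq-morphisms.\<close>

lemma eta_natural:
  assumes CD: "(C, D) \<in> dual_pairs" and X: "sp_obj D X" and Y: "sp_obj D Y" and h: "h \<in> sp_hom D X Y"
  shows "sp_comp X (Fsp_mor D (Omega Y) (Omega X) (Omega_mor X Y h)) (eta D X) = sp_comp X (eta D Y) h"
proof
  fix x
  have hp: "h \<in> p_morphisms X Y" and hq: "triples D \<Longrightarrow> h \<in> pq_morphisms X Y"
    using h by (simp_all add: sp_hom_iff)
  have rX: "rel_space X" and rY: "rel_space Y" using X Y by (simp_all add: sp_obj_iff)
  note A = modal_frame_Omega[OF rY] and B = modal_frame_Omega[OF rX]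
  let ?f = "Omega_mor X Y h"
  have f: "?f \<in> mf_morphisms (Omega Y) (Omega X)" "lower D \<Longrightarrow> dia_strict (Omega Y) (Omega X) ?f"
      "upper D \<Longrightarrow> box_strict (Omega Y) (Omega X) ?f"
    using Omega_mor_hom[OF CD X Y h] by (simp_all add: dual_pairs_frame_hom[OF CD])
  show "sp_comp X (Fsp_mor D (Omega Y) (Omega X) ?f) (eta D X) x = sp_comp X (eta D Y) h x"
  proof (cases "x \<in> topspace (topo X)")
    case x: True
    note hx = p_morphism_in_topspace[OF hp x]
    note ex = eta_in_points[OF X x]
    have "Fsp_mor D (Omega Y) (Omega X) ?f (eta D X x) = eta D Y (h x)"
    proof (rule point_eqI[OF A Fsp_mor_in_points[OF A B f ex] eta_in_points[OF Y hx]])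
      fix V assume Vc: "V \<in> carrier (Omega Y)"
      then have V: "openin (topo Y) V" by simp
      note fV = p_morphism_openin[OF hp V]
      show "ch (Fsp_mor D (Omega Y) (Omega X) ?f (eta D X x)) V \<longleftrightarrow> ch (eta D Y (h x)) V"
        using V fV x by (simp add: ch_Fsp_mor[OF A B f(1) ex] ch_eta[OF x] ch_eta[OF hx] Omega_mor_apply)
      show "V \<sqsubseteq>\<^bsub>Omega Y\<^esub> av (Fsp_mor D (Omega Y) (Omega X) ?f (eta D X x)) \<longleftrightarrow>
          V \<sqsubseteq>\<^bsub>Omega Y\<^esub> av (eta D Y (h x))"
        using le_av_Fsp_mor_iff[OF A B f(1) ex Vc] p_morphism_vimage_disjoint_iff[OF rX hp x V]
        by (simp add: Omega_mor_apply[OF V] subset_av_eta_iff[OF x fV] subset_av_eta_iff[OF hx V])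
      show "V \<in> filt (Omega Y) (Fsp_mor D (Omega Y) (Omega X) ?f (eta D X x)) \<longleftrightarrow>
          V \<in> filt (Omega Y) (eta D Y (h x))" if D: "triples D"
        using pq_morphism_vimage_subset_iff[OF rX hq[OF D] x V] V fV
        by (simp add: filt_Fsp_mor_iff[OF A B f(1) D ex] Omega_mor_apply filt_eta_iff[OF D x] filt_eta_iff[OF D hx])
    qed
    then show ?thesis using x by (simp add: sp_comp_def compose_def)
  qed (simp add: sp_comp_def compose_def)
qed

section \<open>The counit\<close>

lemma phi_map_apply: "c \<in> carrier A \<Longrightarrow> phi_map D A c = phi D A c"
  by (simp add: phi_map_def)

lemma phi_open: "modal_frame A \<Longrightarrow> c \<in> carrier A \<Longrightarrow> openin (topo (Fsp D A)) (phi D A c)"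
  by (auto simp: openin_Fsp_iff)

lemma phi_map_frame_morphism:
  assumes A: "modal_frame A"
  shows "phi_map D A \<in> frame_morphisms A (Omega (Fsp D A))"
proof -
  interpret complete_lattice A by (rule modal_frame_complete_lattice[OF A])
  have char: "ch x \<top>\<^bsub>A\<^esub>"
    "a \<in> carrier A \<Longrightarrow> b \<in> carrier A \<Longrightarrow> ch x (a \<sqinter>\<^bsub>A\<^esub> b) \<longleftrightarrow> ch x a \<and> ch x b"
    "S \<subseteq> carrier A \<Longrightarrow> ch x (\<Squnion>\<^bsub>A\<^esub>S) \<longleftrightarrow> (\<exists>s\<in>S. ch x s)"
    if "x \<in> points D A" for x a b S
    using ch_character[OF that] by (simp_all add: character_iff)
  have "phi_map D A \<in> carrier A \<rightarrow>\<^sub>E carrier (Omega (Fsp D A))"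
    using phi_open[OF A] by (auto simp: phi_map_def)
  moreover have "phi_map D A \<top>\<^bsub>A\<^esub> = \<top>\<^bsub>Omega (Fsp D A)\<^esub>"
    using char(1) by (auto simp: phi_map_apply top_Omega topspace_Fsp[OF A] mem_phi_iff)
  moreover have "phi_map D A (a \<sqinter>\<^bsub>A\<^esub> b) = phi_map D A a \<sqinter>\<^bsub>Omega (Fsp D A)\<^esub> phi_map D A b"
    if "a \<in> carrier A" "b \<in> carrier A" for a b
    using char(2)[OF _ that] that
    by (auto simp: phi_map_apply meet_Omega phi_open[OF A] mem_phi_iff)
  moreover have "phi_map D A (\<Squnion>\<^bsub>A\<^esub>S) = \<Squnion>\<^bsub>Omega (Fsp D A)\<^esub>(phi_map D A ` S)"
    if S: "S \<subseteq> carrier A" for S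
  proof -
    have im: "phi_map D A ` S = phi D A ` S"
      using S by (intro image_cong) (auto simp: phi_map_apply)
    have "phi D A ` S \<subseteq> carrier (Omega (Fsp D A))" using S phi_open[OF A] by auto
    moreover have "phi D A (\<Squnion>\<^bsub>A\<^esub>S) = \<Union>(phi D A ` S)"
      using char(3)[OF _ S] by (auto simp: mem_phi_iff)
    ultimately show ?thesis using sup_closed[OF S] by (simp add: im sup_Omega phi_map_apply)
  qed
  ultimately show ?thesis by (simp add: frame_morphisms_def)
qed

text \<open>The inclusions into \<open>box_rel\<close> and \<open>dia_rel\<close> pass to the
  interiors because each \<open>phi D A c\<close> is open; where they are equalities, the interior
  has no effect and strictness results.\<close>

lemma phi_map_hom:
  assumes CD: "(C, D) \<in> dual_pairs" and A: "modal_frame A"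
  shows "phi_map D A \<in> fr_hom C A (Omega (Fsp D A))"
proof -
  note closed = nec_closed[OF A] pos_closed[OF A]
  have le: "phi D A (nec A c) \<subseteq> topo (Fsp D A) interior_of box_rel (Fsp D A) (phi D A c)"
    "phi D A (pos A c) \<subseteq> topo (Fsp D A) interior_of dia_rel (Fsp D A) (phi D A c)"
    if c: "c \<in> carrier A" for c
    by (simp_all add: interior_of_maximal box_rel_phi_superset dia_rel_phi_superset phi_open A closed c)
  then have "phi_map D A \<in> mf_morphisms A (Omega (Fsp D A))"
    using phi_map_frame_morphism[OF A] by (simp add: mf_morphisms_def phi_map_apply closed)
  moreover have "dia_strict A (Omega (Fsp D A)) (phi_map D A)" if "lower D"
    using that by (simp add: dia_strict_def phi_map_apply closed dia_rel_phi[OF A]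
        interior_of_openin phi_open[OF A])
  moreover have "box_strict A (Omega (Fsp D A)) (phi_map D A)" if "upper D"
    using that by (simp add: box_strict_def phi_map_apply closed box_rel_phi[OF A]
        interior_of_openin phi_open[OF A])
  ultimately show ?thesis by (simp add: dual_pairs_frame_hom[OF CD])
qed

lemma phi_map_natural:
  assumes CD: "(C, D) \<in> dual_pairs" and A: "modal_frame A" and B: "modal_frame B"
    and f: "f \<in> fr_hom C A B"
  shows "fr_comp A (Omega_mor (Fsp D B) (Fsp D A) (Fsp_mor D A B f)) (phi_map D A) =
    fr_comp A (phi_map D B) f"
proof
  fix c
  have F: "f \<in> mf_morphisms A B" "lower D \<Longrightarrow> dia_strict A B f" "upper D \<Longrightarrow> box_strict A B f"
    using f by (simp_all add: dual_pairs_frame_hom[OF CD])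
  show "fr_comp A (Omega_mor (Fsp D B) (Fsp D A) (Fsp_mor D A B f)) (phi_map D A) c =
    fr_comp A (phi_map D B) f c"
  proof (cases "c \<in> carrier A")
    case c: True
    then show ?thesis
      using vimage_Fsp_mor[OF A B F c] mf_closed[OF A B F(1) c]
      by (simp add: fr_comp_def compose_def phi_map_apply Omega_mor_apply phi_open[OF A] topspace_Fsp[OF B])
  qed (simp add: fr_comp_def compose_def)
qed

lemma phi_map_iso:
  assumes CD: "(C, D) \<in> dual_pairs" and X: "sp_obj D X"
  shows "phi_map D (Omega X) \<in> fr_iso C (Omega X) (Omega (Fsp D (Omega X)))"
proof -
  let ?A = "Omega X" and ?B = "Omega (Fsp D (Omega X))"
  let ?g = "Omega_mor X (Fsp D ?A) (eta D X)"
  have A: "modal_frame ?A" using X by (simp add: modal_frame_Omega sp_obj_iff)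
  have g: "?g \<in> fr_hom C ?B ?A"
    by (rule Omega_mor_hom[OF CD X sp_obj_Fsp[OF CD fr_obj_Omega[OF CD X]] eta_hom[OF X]])
  have gphi: "?g (phi D ?A U) = U" if "openin (topo X) U" for U
    using vimage_eta[OF X that] phi_open[OF A, of U] that by (simp add: Omega_mor_apply)
  have "fr_comp ?A ?g (phi_map D ?A) = fr_id ?A"
    by (auto simp: fun_eq_iff fr_comp_def compose_def fr_id_def phi_map_apply gphi restrict_def)
  moreover have "fr_comp ?B (phi_map D ?A) ?g = fr_id ?B"
  proof
    fix V
    show "fr_comp ?B (phi_map D ?A) ?g V = fr_id ?B V"
    proof (cases "V \<in> carrier ?B")
      case True
      \<comment> \<open>Every open set of points has this form, so the second composite follows from
        the first.\<close>
      then obtain U where U: "openin (topo X) U" "V = phi D ?A U" by (auto simp: openin_Fsp_iff[OF A])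
      then show ?thesis using True by (simp add: fr_comp_def compose_def fr_id_def gphi phi_map_apply)
    qed (simp add: fr_comp_def compose_def fr_id_def)
  qed
  ultimately show ?thesis using phi_map_hom[OF CD A] g unfolding fr_iso_def by blast
qed

lemma eta_iso:
  assumes CD: "(C, D) \<in> dual_pairs" and C: "fr_obj C A"
  shows "eta D (Fsp D A) \<in> sp_iso D (Fsp D A) (Fsp D (Omega (Fsp D A)))"
proof -
  let ?X = "Fsp D A"
  let ?B = "Omega ?X"
  let ?Y = "Fsp D ?B"
  let ?f = "phi_map D A"
  let ?g = "Fsp_mor D A ?B ?f"
  have A: "modal_frame A" using C by (simp add: dual_pairs_frame_obj[OF CD])
  have X: "sp_obj D ?X" by (rule sp_obj_Fsp[OF CD C])
  have B: "modal_frame ?B" by (rule modal_frame_Omega[OF rel_space_Fsp[OF A]])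
  have f: "?f \<in> mf_morphisms A ?B" "lower D \<Longrightarrow> dia_strict A ?B ?f" "upper D \<Longrightarrow> box_strict A ?B ?f"
    using phi_map_hom[OF CD A] by (simp_all add: dual_pairs_frame_hom[OF CD])
  have tX: "topspace (topo ?X) = points D A" and tY: "topspace (topo ?Y) = points D ?B"
    by (rule topspace_Fsp[OF A]) (rule topspace_Fsp[OF B])
  have eta: "eta D ?X x \<in> points D ?B" if "x \<in> points D A" for x
    using eta_in_points[OF X] that by (simp add: tX)
  \<comment> \<open>Triangle identity: the three tests at \<open>x\<close> are compared with
    membership of \<open>x\<close> in \<open>phi D A c\<close> and with how its successors lie
    relative to that set.\<close>
  have g_eta: "?g (eta D ?X x) = x" if x: "x \<in> points D A" for x
  proof (rule point_eqI[OF A Fsp_mor_in_points[OF A B f eta[OF x]] x])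
    note x' = x[folded tX]
    fix c assume c: "c \<in> carrier A"
    note op = phi_open[OF A c, of D]
    show "ch (?g (eta D ?X x)) c \<longleftrightarrow> ch x c"
      using c x op by (simp add: ch_Fsp_mor[OF A B f(1) eta[OF x]] ch_eta[OF x'] phi_map_apply mem_phi_iff)
    show "c \<sqsubseteq>\<^bsub>A\<^esub> av (?g (eta D ?X x)) \<longleftrightarrow> c \<sqsubseteq>\<^bsub>A\<^esub> av x"
      by (simp add: le_av_Fsp_mor_iff[OF A B f(1) eta[OF x] c] phi_map_apply[OF c]
          subset_av_eta_iff[OF x' op] acc_Fsp_disjoint_phi_iff[OF A x c])
    show "c \<in> filt A (?g (eta D ?X x)) \<longleftrightarrow> c \<in> filt A x" if D: "triples D"
      using c op by (simp add: filt_Fsp_mor_iff[OF A B f(1) D eta[OF x]] phi_map_apply[OF c]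
          filt_eta_iff[OF D x'] acc_Fsp_subset_phi_iff[OF A D x c])
  qed
  have g_inj: "y = z" if y: "y \<in> points D ?B" and z: "z \<in> points D ?B" and eq: "?g y = ?g z" for y z
  proof (rule point_eqI[OF B y z])
    fix U assume "U \<in> carrier ?B"
    \<comment> \<open>Surjectivity of \<open>phi_map\<close> onto the open sets enters here: each
      test at \<open>U\<close> is a test on \<open>c\<close> at the image under
      \<open>?g\<close>.\<close>
    then obtain c where c: "c \<in> carrier A" "U = ?f c" by (auto simp: openin_Fsp_iff[OF A] phi_map_apply)
    show "ch y U \<longleftrightarrow> ch z U"
      using ch_Fsp_mor[OF A B f(1) y] ch_Fsp_mor[OF A B f(1) z] eq c
      by (metis restrict_apply')
    show "U \<sqsubseteq>\<^bsub>?B\<^esub> av y \<longleftrightarrow> U \<sqsubseteq>\<^bsub>?B\<^esub> av z"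
      using le_av_Fsp_mor_iff[OF A B f(1) y c(1)] le_av_Fsp_mor_iff[OF A B f(1) z c(1)] eq c(2) by simp
    show "U \<in> filt ?B y \<longleftrightarrow> U \<in> filt ?B z" if D: "triples D"
      using filt_Fsp_mor_iff[OF A B f(1) D y, of c] filt_Fsp_mor_iff[OF A B f(1) D z, of c] eq c by simp
  qed
  have "sp_comp ?X ?g (eta D ?X) = sp_id ?X"
    by (auto simp: fun_eq_iff sp_comp_def compose_def sp_id_def tX g_eta restrict_def)
  moreover have "eta D ?X (?g z) = z" if z: "z \<in> points D ?B" for z
  proof -
    have "?g z \<in> points D A" by (rule Fsp_mor_in_points[OF A B f z])
    \<comment> \<open>\<open>?g\<close> sends both \<open>eta D ?X (?g z)\<close> and
      \<open>z\<close> to \<open>?g z\<close>, so injectivity upgrades the one-sided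
      inverse.\<close>
    then show ?thesis using g_inj[OF eta z g_eta] by blast
  qed
  then have "sp_comp ?Y (eta D ?X) ?g = sp_id ?Y"
    by (auto simp: fun_eq_iff sp_comp_def compose_def sp_id_def tY restrict_def)
  ultimately show ?thesis
    using eta_hom[OF X] Fsp_mor_hom[OF A B f] unfolding sp_iso_def by blast
qed

section \<open>The duality\<close>

lemma Omega_imageD:
  assumes "(C, D) \<in> dual_pairs" "A \<in> Omega_image D"
  shows "modal_frame A" "fr_obj C A" "Fsp D A \<in> Fsp_image C D" "phi_map D A \<in> fr_iso C A (Omega (Fsp D A))"
proof -
  obtain X where X: "A = Omega X" "sp_obj D X" using assms(2) by (auto simp: Omega_image_def)
  show "modal_frame A" using X by (simp add: sp_obj_iff modal_frame_Omega)
  show obj: "fr_obj C A" using fr_obj_Omega[OF assms(1) X(2)] X(1) by simp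
  then show "Fsp D A \<in> Fsp_image C D" by (auto simp: Fsp_image_def)
  show "phi_map D A \<in> fr_iso C A (Omega (Fsp D A))" using phi_map_iso[OF assms(1) X(2)] X(1) by simp
qed

lemma Fsp_imageD:
  assumes "(C, D) \<in> dual_pairs" "X \<in> Fsp_image C D"
  shows "rel_space X" "sp_obj D X" "Omega X \<in> Omega_image D" "eta D X \<in> sp_iso D X (Fsp D (Omega X))"
proof -
  obtain A where A: "X = Fsp D A" "fr_obj C A" using assms(2) by (auto simp: Fsp_image_def)
  show obj: "sp_obj D X" using sp_obj_Fsp[OF assms(1) A(2)] A(1) by simp
  then show "rel_space X" by (simp add: sp_obj_iff)
  show "Omega X \<in> Omega_image D" using obj by (auto simp: Omega_image_def)
  show "eta D X \<in> sp_iso D X (Fsp D (Omega X))" using eta_iso[OF assms(1) A(2)] A(1) by simp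
qed

lemma Fsp_mor_fr_hom:
  assumes CD: "(C, D) \<in> dual_pairs" and A: "modal_frame A" and B: "modal_frame B"
    and f: "f \<in> fr_hom C A B"
  shows "Fsp_mor D A B f \<in> sp_hom D (Fsp D B) (Fsp D A)"
  using f by (intro Fsp_mor_hom[OF A B]) (simp_all add: dual_pairs_frame_hom[OF CD])

theorem theorem2:
  assumes "(C, D) \<in> dual_pairs"
  shows
    "(\<forall>A \<in> (Omega_image D :: 'x set mframe set).
        fr_obj C A \<and> fr_id A \<in> fr_hom C A A \<and>
        Fsp D A \<in> Fsp_image C D \<and>
        Fsp_mor D A A (fr_id A) = sp_id (Fsp D A) \<and>
        phi_map D A \<in> fr_iso C A (Omega (Fsp D A))) \<and>
     (\<forall>A \<in> (Omega_image D :: 'x set mframe set).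
      \<forall>B \<in> (Omega_image D :: 'y set mframe set).
      \<forall>f \<in> fr_hom C A B.
        Fsp_mor D A B f \<in> sp_hom D (Fsp D B) (Fsp D A) \<and>
        fr_comp A (Omega_mor (Fsp D B) (Fsp D A) (Fsp_mor D A B f)) (phi_map D A) =
          fr_comp A (phi_map D B) f) \<and>
     (\<forall>A \<in> (Omega_image D :: 'x set mframe set).
      \<forall>B \<in> (Omega_image D :: 'y set mframe set).
      \<forall>E \<in> (Omega_image D :: 'z set mframe set).
      \<forall>f \<in> fr_hom C A B. \<forall>g \<in> fr_hom C B E.
        fr_comp A g f \<in> fr_hom C A E \<and>
        Fsp_mor D A E (fr_comp A g f) =
          sp_comp (Fsp D E) (Fsp_mor D A B f) (Fsp_mor D B E g)) \<and>
     (\<forall>X \<in> (Fsp_image C D :: 'a pt rspace set).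
        sp_obj D X \<and> sp_id X \<in> sp_hom D X X \<and>
        Omega X \<in> Omega_image D \<and>
        Omega_mor X X (sp_id X) = fr_id (Omega X) \<and>
        eta D X \<in> sp_iso D X (Fsp D (Omega X))) \<and>
     (\<forall>X \<in> (Fsp_image C D :: 'a pt rspace set).
      \<forall>Y \<in> (Fsp_image C D :: 'b pt rspace set).
      \<forall>h \<in> sp_hom D X Y.
        Omega_mor X Y h \<in> fr_hom C (Omega Y) (Omega X) \<and>
        sp_comp X (Fsp_mor D (Omega Y) (Omega X) (Omega_mor X Y h)) (eta D X) =
          sp_comp X (eta D Y) h) \<and>
     (\<forall>X \<in> (Fsp_image C D :: 'a pt rspace set).
      \<forall>Y \<in> (Fsp_image C D :: 'b pt rspace set).
      \<forall>Z \<in> (Fsp_image C D :: 'c pt rspace set).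
      \<forall>h \<in> sp_hom D X Y. \<forall>k \<in> sp_hom D Y Z.
        sp_comp X k h \<in> sp_hom D X Z \<and>
        Omega_mor X Z (sp_comp X k h) =
          fr_comp (Omega Z) (Omega_mor X Y h) (Omega_mor Y Z k))"
  by (intro conjI ballI Omega_imageD[OF assms] Fsp_imageD[OF assms] fr_id_hom[OF assms]
      Fsp_mor_fr_id[OF assms] Fsp_mor_fr_hom[OF assms] phi_map_natural[OF assms] fr_comp_hom[OF assms]
      Fsp_mor_fr_comp[OF assms] sp_id_hom Omega_mor_sp_id Omega_mor_hom[OF assms] eta_natural[OF assms]
      sp_comp_hom Omega_mor_sp_comp) (assumption | rule Omega_imageD[OF assms] Fsp_imageD[OF assms])+

end
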